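(* Let $m,n\ge 1$ be integers, let $1<p_i<\infty$ for $i=1,\dots,m$, and let $p$ be defined by $\frac1p=\sum_{i=1}^m\frac1{p_i}$. Suppose that $p<q<\infty$ and $0<\alpha<mn$. Let $u,w_1,\dots,w_m$ be a.e. positive measurable functions on $\mathbb{R}^n$ such that $w_i^{-p_i'}$ satisfies the reverse doubling condition on $\mathbb{R}^n$ for each $i=1,\dots,m$. Then there is a constant $C>0$ such that the inequality $$\| u\,\mathcal{M}_{\alpha}(\overrightarrow{f})\|_{L^q(\mathbb{R}^n)} \leq C \prod_{i=1}^{m} \|w_i f_i \|_{L^{p_i}(\mathbb{R}^n)}$$ holds for all $\overrightarrow{f}=(f_1,\dots,f_m) \in L^{p_1}_{w_1^{p_1}}(\mathbb{R}^n) \times \cdots \times L^{p_m}_{w_m^{p_m}}(\mathbb{R}^n)$ if and only if $$\sup_{Q\in \mathcal{Q}} |Q|^{\alpha/n+1/q-1/p} \bigg( \frac{1}{|Q|} \int_{Q} u^{q}(x)\, dx \bigg)^{1/q} \prod_{i=1}^m \bigg( \frac{1}{|Q|} \int_{Q} w_i^{-p'_i}(y_i)\, dy_i \bigg)^{1/p'_i}< \infty.$$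
   Context: $p_i'=p_i/(p_i-1)$. $\mathcal{Q}$ is the family of all cubes in $\mathbb{R}^n$ with sides parallel to the coordinate axes, and $|Q|$ is the volume of $Q$. A weight is an a.e. positive, locally integrable function. For a.e. positive $\rho$ and $0<r<\infty$, $L^r_\rho(\mathbb{R}^n)$ is the class of measurable $f$ with $\|f\|_{L^r_\rho}=\big(\int_{\mathbb{R}^n}|f|^r\rho\,dx\big)^{1/r}<\infty$. The multi(sub)linear fractional maximal operator is $$\mathcal{M}_{\alpha} (\overrightarrow{f})(x) =\sup_{Q\in\mathcal{Q},\,Q\ni x}\ \prod_{i=1}^m \frac{1}{ |Q|^{1-\alpha/(nm)}} \int_{Q} |f_i(y_i)|\, d y_i .$$ A weight $\rho$ on $\mathbb{R}^n$ satisfies the reverse doubling condition ($\rho\in RD(\mathbb{R}^n)$) if there is a constant $d>1$ such that $d\,\rho(Q')\le\rho(Q)$ for all cubes $Q\in\mathcal{Q}$ and all $Q'$ that are one of the $2^n$ equal subcubes arising by dividing $Q$ into $2^n$ equal parts, where $\rho(E)=\int_E\rho\,dx$. *)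

theory Defs
  imports "HOL-Analysis.Analysis"
begin

text \<open>Integrals are Lebesgue integrals with values in \<open>[0, \<infinity>]\<close> (type \<^typ>\<open>ennreal\<close>), so that they
  are meaningful without integrability assumptions. Real powers are extended to \<open>[0, \<infinity>]\<close> by
  \<open>\<infinity>\<^sup>r = \<infinity>\<close>; this is only used for exponents \<open>r > 0\<close>.\<close>

definition epowr :: "ennreal \<Rightarrow> real \<Rightarrow> ennreal" (infixr "epowr" 80) where
  "a epowr r = (if a = \<infinity> then \<infinity> else ennreal (enn2real a powr r))"

definition conj_exponent :: "real \<Rightarrow> real" where
  "conj_exponent p = p / (p - 1)"

definition cube :: "real ^ 'n \<Rightarrow> real \<Rightarrow> (real ^ 'n) set" where
  "cube a h = cbox a (\<chi> i. a $ i + h)"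

text \<open>Cubes are taken closed and nondegenerate. Using open cubes instead changes none of the notions
  below: faces are null sets, and a point of a closed cube lies in open cubes that contain it and
  are arbitrarily little larger.\<close>

definition cubes :: "(real ^ 'n) set set" where
  "cubes = {cube a h | a h. h > 0}"

definition weight :: "(real ^ 'n \<Rightarrow> real) \<Rightarrow> bool" where
  "weight \<rho> \<longleftrightarrow> \<rho> \<in> borel_measurable lebesgue \<and> (AE x in lebesgue. \<rho> x > 0) \<and>
     (\<forall>K. compact K \<longrightarrow> set_integrable lebesgue K \<rho>)"

definition weighted_measure :: "(real ^ 'n \<Rightarrow> real) \<Rightarrow> (real ^ 'n) set \<Rightarrow> ennreal" where
  "weighted_measure \<rho> E = (\<integral>\<^sup>+x\<in>E. ennreal (\<rho> x) \<partial>lebesgue)"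

text \<open>The \<open>2\<^sup>n\<close> equal subcubes of \<open>cube a h\<close> are the \<open>cube (a + (h / 2) e) (h / 2)\<close> with
  \<open>e \<in> {0, 1}\<^sup>n\<close>.\<close>

definition reverse_doubling :: "(real ^ 'n \<Rightarrow> real) \<Rightarrow> bool" where
  "reverse_doubling \<rho> \<longleftrightarrow> weight \<rho> \<and>
     (\<exists>d::real. d > 1 \<and>
        (\<forall>a h e. h > 0 \<longrightarrow> (\<forall>i. e $ i \<in> {0, 1}) \<longrightarrow>
           ennreal d * weighted_measure \<rho> (cube (a + (h / 2) *\<^sub>R e) (h / 2))
             \<le> weighted_measure \<rho> (cube a h)))"

definition Lnorm :: "real \<Rightarrow> (real ^ 'n \<Rightarrow> ennreal) \<Rightarrow> ennreal" where
  "Lnorm r g = (\<integral>\<^sup>+x. g x epowr r \<partial>lebesgue) epowr (1 / r)"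

definition weighted_Lnorm :: "(real ^ 'n \<Rightarrow> real) \<Rightarrow> real \<Rightarrow> (real ^ 'n \<Rightarrow> real) \<Rightarrow> ennreal" where
  "weighted_Lnorm \<rho> r f = (\<integral>\<^sup>+x. ennreal (\<bar>f x\<bar> powr r * \<rho> x) \<partial>lebesgue) epowr (1 / r)"

definition weighted_L :: "(real ^ 'n \<Rightarrow> real) \<Rightarrow> real \<Rightarrow> (real ^ 'n \<Rightarrow> real) set" where
  "weighted_L \<rho> r = {f \<in> borel_measurable lebesgue. weighted_Lnorm \<rho> r f < \<infinity>}"

definition avg :: "(real ^ 'n) set \<Rightarrow> (real ^ 'n \<Rightarrow> real) \<Rightarrow> ennreal" where
  "avg Q g = ennreal (1 / measure lebesgue Q) * (\<integral>\<^sup>+x\<in>Q. ennreal (g x) \<partial>lebesgue)"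

definition frac_maximal ::
    "real \<Rightarrow> nat \<Rightarrow> (nat \<Rightarrow> real ^ 'n \<Rightarrow> real) \<Rightarrow> real ^ 'n \<Rightarrow> ennreal" where
  "frac_maximal \<alpha> m f x =
     (SUP Q \<in> {Q \<in> cubes. x \<in> Q}.
        \<Prod>i=1..m. ennreal (1 / measure lebesgue Q powr (1 - \<alpha> / (real CARD('n) * real m)))
                   * (\<integral>\<^sup>+y\<in>Q. ennreal \<bar>f i y\<bar> \<partial>lebesgue))"

end

theory Submission
  imports Defs
begin

text \<open>Write \<open>\<sigma>\<^sub>i\<close> for the \<open>i\<close>-th dual weight (the power \<open>- p\<^sub>i'\<close> of \<open>w\<^sub>i\<close>). Necessity of the condition
  follows by testing with \<open>f\<^sub>i = \<sigma>\<^sub>i 1\<^sub>Q\<close>. Conversely, every cube containing \<open>x\<close> lies in the triple \<open>3P\<close>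
  of a grid cube \<open>P\<close> of comparable size with \<open>x \<in> P\<close>, so the \<open>q\<close>-th power of the maximal function is at
  most a sum over all grid cubes of all scales. With the condition on the dilates \<open>5P\<close> and the weighted
  arithmetic-geometric mean inequality with weights \<open>p / p\<^sub>i\<close>, the claim reduces to the one-weight
  estimate that, for \<open>r > p > 1\<close>, the sum over \<open>P\<close> of the \<open>r\<close>-th powers of
  \<open>\<sigma>(5P) powr (1 / p - 1) * (\<integral>g d\<sigma> over 3P)\<close> is bounded as long as \<open>\<integral>g powr p d\<sigma> \<le> 1\<close>
  (applied with \<open>p = p\<^sub>i\<close>, \<open>r = p\<^sub>i q / p\<close>). For this, split \<open>g\<close> at height \<open>\<sigma>(5P) powr (- 1 / p)\<close>,
  exchange sum and integral, and sum over all \<open>P\<close> with \<open>y \<in> 3P\<close>: by reverse doubling the numbers \<open>\<sigma>(5P)\<close>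
  grow geometrically with the scale, so both parts give geometric series bounded by a multiple of
  \<open>g(y) powr p\<close>.\<close>

section \<open>Geometric sums and crude inequalities\<close>

text \<open>Everything is compared with the lowest level \<open>l\<close> that occurs. There
  \<open>V\<close> is at least \<open>t\<close>, so the growth hypothesis makes \<open>V P\<close>
  at least \<open>t\<close> times \<open>d\<close> to the power \<open>lev P - l\<close>. With at
  most \<open>N\<close> indices per level, the sum is dominated by \<open>N\<close> times a
  geometric series of ratio \<open>d powr (- b)\<close>. The bound is independent of
  \<open>A\<close>, so it survives the passage to infinite index sets.\<close>

lemma sum_geometric_levels_le:
  fixes lev :: "'i \<Rightarrow> int" and V :: "'i \<Rightarrow> real"
  assumes "finite A" and d: "d > 1" and b: "b > 0" and t: "t > 0"
    and N: "\<And>k. card {P \<in> A. lev P = k} \<le> N"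
    and growth: "\<And>P P'. P \<in> A \<Longrightarrow> P' \<in> A \<Longrightarrow> lev P < lev P' \<Longrightarrow>
                   d ^ nat (lev P' - lev P) * V P \<le> V P'"
    and tV: "\<And>P. P \<in> A \<Longrightarrow> t \<le> V P"
  shows "(\<Sum>P\<in>A. V P powr (- b)) \<le> real N / (1 - d powr (- b)) * t powr (- b)"
proof (cases "A = {}")
  case True
  have "d powr (- b) < 1" using d b by (simp add: powr_less_one)
  then show ?thesis using True by simp
next
  case False
  define x where "x = d powr (- b)"
  have x: "0 < x" "x < 1" using d b by (auto simp: x_def powr_less_one)
  define l where "l = Min (lev ` A)"
  define e where "e P = nat (lev P - l)" for P
  have l: "l \<in> lev ` A" "\<And>P. P \<in> A \<Longrightarrow> l \<le> lev P"
    using \<open>finite A\<close> False by (auto simp: l_def)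
  then obtain P0 where P0: "P0 \<in> A" "lev P0 = l" by auto
  have V: "d ^ e P * t \<le> V P" if "P \<in> A" for P
  proof (cases "lev P = l")
    case True
    then show ?thesis using tV[OF that] by (simp add: e_def)
  next
    case False
    then have "lev P0 < lev P" using l(2)[OF that] P0 by simp
    from growth[OF P0(1) that this] have "d ^ e P * V P0 \<le> V P" by (simp add: e_def P0)
    moreover have "d ^ e P * t \<le> d ^ e P * V P0" using tV[OF P0(1)] d by simp
    ultimately show ?thesis by linarith
  qed
  have "V P powr (- b) \<le> x ^ e P * t powr (- b)" if "P \<in> A" for P
  proof -
    have "V P powr (- b) \<le> (d ^ e P * t) powr (- b)"
      using V[OF that] b d t by (intro powr_mono2') auto
    also have "\<dots> = x ^ e P * t powr (- b)"
      using d t by (simp add: powr_mult x_def powr_powr mult.commute flip: powr_realpow)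
    finally show ?thesis .
  qed
  then have "(\<Sum>P\<in>A. V P powr (- b)) \<le> (\<Sum>P\<in>A. x ^ e P * t powr (- b))"
    by (rule sum_mono)
  also have "\<dots> = (\<Sum>P\<in>A. x ^ e P) * t powr (- b)" by (simp add: sum_distrib_right)
  also have "(\<Sum>P\<in>A. x ^ e P) = (\<Sum>k\<in>e ` A. \<Sum>P | P \<in> A \<and> e P = k. x ^ e P)"
    by (rule sum.image_gen[OF \<open>finite A\<close>])
  also have "\<dots> \<le> (\<Sum>k\<in>e ` A. real N * x ^ k)"
  proof (rule sum_mono)
    fix k assume "k \<in> e ` A"
    have "card {P \<in> A. e P = k} \<le> card {P \<in> A. lev P = l + int k}"
      using l(2) \<open>finite A\<close> by (intro card_mono) (auto simp: e_def)
    also note N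
    finally show "(\<Sum>P | P \<in> A \<and> e P = k. x ^ e P) \<le> real N * x ^ k"
      using x by (simp add: mult_right_mono)
  qed
  \<comment> \<open>The exponents that occur may have gaps; filling them in gives a full initial
    segment of the geometric series.\<close>
  also have "\<dots> \<le> (\<Sum>k<Suc (Max (e ` A)). real N * x ^ k)"
    using \<open>finite A\<close> x by (intro sum_mono2) (auto simp: less_Suc_eq_le)
  also have "\<dots> = real N * ((1 - x ^ Suc (Max (e ` A))) / (1 - x))"
    using x by (simp only: sum_distrib_left[symmetric] sum_gp_strict) simp
  also have "\<dots> \<le> real N * (1 / (1 - x))"
    using x by (intro mult_left_mono divide_right_mono) auto
  finally show ?thesis by (simp add: x_def mult_right_mono)
qed

text \<open>A sum over a countable type is the limit of finite partial sums along the enumeration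
  \<open>to_nat\<close>, so bounds that are uniform over finite subsets pass to the whole
  sum.\<close>

lemma nn_integral_count_space_le:
  fixes f :: "'i::countable \<Rightarrow> ennreal"
  assumes "\<And>A. finite A \<Longrightarrow> (\<Sum>a\<in>A. f a) \<le> C"
  shows "(\<integral>\<^sup>+a. f a \<partial>count_space UNIV) \<le> C"
proof -
  define F where "F n a = f a * indicator {a. to_nat a < n} a" for n :: nat and a
  have fin: "finite {a::'i. to_nat a < n}" for n
    using finite_vimageI[OF finite_lessThan[of n] inj_to_nat[where 'a='i]]
    by (simp add: vimage_def)
  have "(SUP n. F n a) = f a" for a
  proof (rule antisym)
    show "f a \<le> (SUP n. F n a)"
      by (rule SUP_upper2[of "Suc (to_nat a)"]) (auto simp: F_def)
  qed (auto simp: F_def indicator_def intro!: SUP_least)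
  then have "(\<integral>\<^sup>+a. f a \<partial>count_space UNIV) = (\<integral>\<^sup>+a. (SUP n. F n a) \<partial>count_space UNIV)"
    by simp
  also have "\<dots> = (SUP n. \<integral>\<^sup>+a. F n a \<partial>count_space UNIV)"
    by (rule nn_integral_monotone_convergence_SUP)
       (auto simp: incseq_def F_def le_fun_def indicator_def)
  also have "\<dots> \<le> C"
  proof (rule SUP_least)
    fix n
    have "(\<integral>\<^sup>+a. F n a \<partial>count_space UNIV) = (\<Sum>a | to_nat a < n. F n a)"
      by (rule nn_integral_count_space') (auto simp: fin F_def)
    also have "\<dots> = (\<Sum>a | to_nat a < n. f a)" by (simp add: F_def)
    also have "\<dots> \<le> C" using assms[OF fin] .
    finally show "(\<integral>\<^sup>+a. F n a \<partial>count_space UNIV) \<le> C" .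
  qed
  finally show ?thesis .
qed

text \<open>Jensen's inequality for \<open>exp\<close> at the points \<open>ln (c i)\<close>. If
  some \<open>c i\<close> vanishes, the product is 0 and no logarithm is taken.\<close>

lemma weighted_arith_geom_mean:
  fixes c \<theta> :: "'a \<Rightarrow> real"
  assumes "finite I" "I \<noteq> {}" "\<And>i. i \<in> I \<Longrightarrow> c i \<ge> 0" "\<And>i. i \<in> I \<Longrightarrow> \<theta> i > 0"
    and "(\<Sum>i\<in>I. \<theta> i) = 1"
  shows "(\<Prod>i\<in>I. c i powr \<theta> i) \<le> (\<Sum>i\<in>I. \<theta> i * c i)"
proof (cases "\<exists>i\<in>I. c i = 0")
  case True
  then have "(\<Prod>i\<in>I. c i powr \<theta> i) = 0" using \<open>finite I\<close> by auto
  also have "0 \<le> (\<Sum>i\<in>I. \<theta> i * c i)"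
    by (intro sum_nonneg mult_nonneg_nonneg) (auto simp: assms less_imp_le)
  finally show ?thesis .
next
  case False
  then have pos: "c i > 0" if "i \<in> I" for i using assms(3) that by (simp add: order_less_le)
  have "(\<Prod>i\<in>I. c i powr \<theta> i) = exp (\<Sum>i\<in>I. \<theta> i * ln (c i))"
    using False by (auto simp: powr_def exp_sum \<open>finite I\<close> intro!: prod.cong)
  also have "\<dots> = exp (\<Sum>i\<in>I. \<theta> i *\<^sub>R ln (c i))" by simp
  also have "\<dots> \<le> (\<Sum>i\<in>I. \<theta> i * exp (ln (c i)))"
    by (rule convex_on_sum[OF _ _ exp_convex]) (auto simp: assms less_imp_le)
  also have "\<dots> = (\<Sum>i\<in>I. \<theta> i * c i)" using pos by simp
  finally show ?thesis .
qed

text \<open>Hoelder's inequality up to a factor 2, from the pointwise bound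
  \<open>g x \<le> \<mu> + \<mu> powr (1 - r) * g x powr r\<close>: below the height
  \<open>\<mu>\<close> the first summand suffices, above it the second.\<close>

lemma nn_integral_Hoelder_crude:
  fixes g :: "'a \<Rightarrow> real"
  assumes [measurable]: "g \<in> borel_measurable M" "S \<in> sets M"
    and g: "\<And>x. g x \<ge> 0" and r: "r > 1" and V: "V > 0" "emeasure M S \<le> ennreal V"
    and J: "J \<ge> 0" "(\<integral>\<^sup>+x\<in>S. ennreal (g x powr r) \<partial>M) \<le> ennreal J"
  shows "(\<integral>\<^sup>+x\<in>S. ennreal (g x) \<partial>M) \<le> ennreal (2 * V powr (1 - 1 / r) * J powr (1 / r))"
proof (cases "J = 0")
  case True
  then have "(\<integral>\<^sup>+x\<in>S. ennreal (g x powr r) \<partial>M) = 0" using J by simp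
  then have "AE x in M. ennreal (g x powr r) * indicator S x = 0"
    by (subst (asm) nn_integral_0_iff_AE) auto
  then have "AE x in M. ennreal (g x) * indicator S x = 0"
    by eventually_elim (auto simp: indicator_def ennreal_eq_0_iff split: if_splits)
  then have "(\<integral>\<^sup>+x\<in>S. ennreal (g x) \<partial>M) = 0"
    by (subst nn_integral_0_iff_AE) auto
  then show ?thesis by simp
next
  case False
  \<comment> \<open>This height balances the two summands: \<open>\<mu> * V\<close> and
    \<open>\<mu> powr (1 - r) * J\<close> both equal
    \<open>V powr (1 - 1 / r) * J powr (1 / r)\<close>.\<close>
  define \<mu> where "\<mu> = (J / V) powr (1 / r)"
  have \<mu>: "\<mu> > 0" using False J V by (simp add: \<mu>_def)
  have pt: "g x \<le> \<mu> + \<mu> powr (1 - r) * g x powr r" for x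
  proof (cases "g x \<le> \<mu>")
    case False
    then have gx: "g x > 0" using \<mu> by simp
    have "g x = g x powr (1 - r) * g x powr r" using gx by (simp flip: powr_add)
    also have "\<dots> \<le> \<mu> powr (1 - r) * g x powr r"
      using False \<mu> r by (intro mult_right_mono powr_mono2') auto
    finally show ?thesis using \<mu> by linarith
  qed (simp add: add_increasing2)
  have "(\<integral>\<^sup>+x\<in>S. ennreal (g x) \<partial>M)
      \<le> (\<integral>\<^sup>+x. ennreal \<mu> * indicator S x
            + ennreal (\<mu> powr (1 - r)) * (ennreal (g x powr r) * indicator S x) \<partial>M)"
    using pt \<mu> by (intro nn_integral_mono)
      (auto simp: indicator_def simp flip: ennreal_mult ennreal_plus intro!: ennreal_leI)
  also have "\<dots> = ennreal \<mu> * emeasure M S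
      + ennreal (\<mu> powr (1 - r)) * (\<integral>\<^sup>+x\<in>S. ennreal (g x powr r) \<partial>M)"
    by (subst nn_integral_add) (auto simp: nn_integral_cmult)
  also have "\<dots> \<le> ennreal \<mu> * ennreal V + ennreal (\<mu> powr (1 - r)) * ennreal J"
    by (intro add_mono mult_left_mono V J) auto
  also have "\<dots> = ennreal (\<mu> * V + \<mu> powr (1 - r) * J)"
    using \<mu> V J by (simp add: ennreal_mult)
  also have "\<mu> * V = V powr (1 - 1 / r) * J powr (1 / r)"
    using V J r by (simp add: \<mu>_def powr_divide powr_diff)
  also have "\<mu> powr (1 - r) * J = V powr (1 - 1 / r) * J powr (1 / r)"
  proof -
    have "\<mu> powr (1 - r) = (J / V) powr (1 / r - 1)"
      using r by (simp add: \<mu>_def powr_powr field_simps)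
    also have "\<dots> = J powr (1 / r) / J * (V / V powr (1 / r))"
      using False V J by (simp add: powr_divide powr_diff)
    finally show ?thesis using False V J by (simp add: powr_diff)
  qed
  finally show ?thesis by (simp add: mult_ac)
qed

section \<open>The one-weight embedding\<close>

lemma powr_add_le:
  fixes x y r :: real
  assumes "x \<ge> 0" "y \<ge> 0" "r > 0"
  shows "(x + y) powr r \<le> 2 powr r * (x powr r + y powr r)"
proof -
  have "(x + y) powr r \<le> (2 * max x y) powr r"
    using assms by (intro powr_mono2) auto
  also have "\<dots> = 2 powr r * (max x y) powr r" using assms by (simp add: powr_mult)
  also have "\<dots> \<le> 2 powr r * (x powr r + y powr r)"
    by (intro mult_left_mono) (auto simp: max_def)
  finally show ?thesis .
qed

text \<open>For the part of \<open>g\<close> above the height, Hoelder with exponent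
  \<open>p\<close> bounds the integral by \<open>2 * V powr (1 - 1 / p)\<close>; this is inserted
  for \<open>r - 1\<close> of its \<open>r\<close> powers, and a single power remains. For the part
  below, Hoelder with exponent \<open>r\<close> is applied. Both terms on the right are then
  integrals in the first power, so that a later sum over many sets can be moved inside.\<close>

lemma nn_integral_split_bound:
  fixes g :: "'a \<Rightarrow> real" and V p r :: real
  assumes [measurable]: "g \<in> borel_measurable M" "S \<in> sets M"
    and g: "\<And>x. g x \<ge> 0" and p: "p > 1" "p < r"
    and V: "V > 0" "emeasure M S \<le> ennreal V"
    and g1: "(\<integral>\<^sup>+x. ennreal (g x powr p) \<partial>M) \<le> 1"
  shows "(\<integral>\<^sup>+x\<in>S. ennreal (g x) \<partial>M) < \<infinity>"
    and "ennreal ((V powr (1 / p - 1) * enn2real (\<integral>\<^sup>+x\<in>S. ennreal (g x) \<partial>M)) powr r)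
      \<le> ennreal (4 powr r)
          * ((\<integral>\<^sup>+x. ennreal (g x) * (ennreal (V powr (1 / p - 1)) * indicator {x\<in>S. V powr (- 1 / p) < g x} x) \<partial>M)
           + (\<integral>\<^sup>+x. ennreal (g x powr r) * (ennreal (V powr (r / p - 1)) * indicator {x\<in>S. 0 < g x \<and> g x \<le> V powr (- 1 / p)} x) \<partial>M))"
proof -
  define l where "l = V powr (- 1 / p)"
  define h k where "h x = (if l < g x then g x else 0)" and "k x = (if l < g x then 0 else g x)" for x
  have [measurable]: "h \<in> borel_measurable M" "k \<in> borel_measurable M"
    unfolding h_def k_def by measurable
  have hk: "h x \<ge> 0" "k x \<ge> 0" "g x = h x + k x" for x using g by (auto simp: h_def k_def)
  have sp: "(\<integral>\<^sup>+x\<in>S. ennreal (g x) \<partial>M) = (\<integral>\<^sup>+x\<in>S. ennreal (h x) \<partial>M) + (\<integral>\<^sup>+x\<in>S. ennreal (k x) \<partial>M)"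
    by (subst nn_integral_add[symmetric]) (auto intro!: nn_integral_cong simp: hk(3) ennreal_plus[OF hk(1,2)] indicator_def)
  have "(\<integral>\<^sup>+x\<in>S. ennreal (h x) \<partial>M) \<le> ennreal (2 * V powr (1 - 1 / p) * 1 powr (1 / p))"
  proof (rule nn_integral_Hoelder_crude)
    have "(\<integral>\<^sup>+x\<in>S. ennreal (h x powr p) \<partial>M) \<le> (\<integral>\<^sup>+x. ennreal (g x powr p) \<partial>M)"
      using g by (intro nn_integral_mono) (auto simp: h_def indicator_def)
    with g1 show "(\<integral>\<^sup>+x\<in>S. ennreal (h x powr p) \<partial>M) \<le> ennreal 1" by simp
  qed (use p V hk in auto)
  then obtain b where b: "(\<integral>\<^sup>+x\<in>S. ennreal (h x) \<partial>M) = ennreal b" "0 \<le> b" "b \<le> 2 * V powr (1 - 1 / p)"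
    by (cases "\<integral>\<^sup>+x\<in>S. ennreal (h x) \<partial>M") (auto simp: top_unique)
  have "(\<integral>\<^sup>+x\<in>S. ennreal (k x powr r) \<partial>M) \<le> (\<integral>\<^sup>+x\<in>S. ennreal (l powr r) \<partial>M)"
    using p g by (intro nn_integral_mono) (auto simp: k_def indicator_def intro!: powr_mono2 ennreal_leI)
  also have "\<dots> = ennreal (l powr r) * emeasure M S" by (simp add: nn_integral_cmult)
  also have "\<dots> < \<infinity>" using V by (auto simp: ennreal_mult_less_top intro: le_less_trans)
  \<comment> \<open>The lower part is at most \<open>l\<close> on a set of finite measure, which
    makes \<open>J\<close> finite.\<close>
  finally obtain J where J: "(\<integral>\<^sup>+x\<in>S. ennreal (k x powr r) \<partial>M) = ennreal J" "0 \<le> J"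
    by (cases "\<integral>\<^sup>+x\<in>S. ennreal (k x powr r) \<partial>M") auto
  have "(\<integral>\<^sup>+x\<in>S. ennreal (k x) \<partial>M) \<le> ennreal (2 * V powr (1 - 1 / r) * J powr (1 / r))"
    by (rule nn_integral_Hoelder_crude) (use p V hk J in auto)
  then obtain c where c: "(\<integral>\<^sup>+x\<in>S. ennreal (k x) \<partial>M) = ennreal c" "0 \<le> c" "c \<le> 2 * V powr (1 - 1 / r) * J powr (1 / r)"
    by (cases "\<integral>\<^sup>+x\<in>S. ennreal (k x) \<partial>M") (auto simp: top_unique)
  have a: "(\<integral>\<^sup>+x\<in>S. ennreal (g x) \<partial>M) = ennreal (b + c)" using sp b c by simp
  then show "(\<integral>\<^sup>+x\<in>S. ennreal (g x) \<partial>M) < \<infinity>" by simp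
  have "b powr r = b powr (r - 1) * b"
    using b p by (cases "b = 0") (auto simp: powr_diff)
  also have "\<dots> \<le> (2 * V powr (1 - 1 / p)) powr (r - 1) * b"
    using b p by (intro mult_right_mono powr_mono2) auto
  also have "\<dots> \<le> 2 powr r * V powr ((1 - 1 / p) * (r - 1)) * b"
    using b by (intro mult_right_mono) (auto simp: powr_mult powr_powr intro!: mult_right_mono)
  finally have "V powr ((1 / p - 1) * r) * b powr r
      \<le> V powr ((1 / p - 1) * r) * (2 powr r * V powr ((1 - 1 / p) * (r - 1)) * b)"
    by (intro mult_left_mono) auto
  also have "\<dots> = 2 powr r * V powr ((1 / p - 1) * r + (1 - 1 / p) * (r - 1)) * b"
    by (simp add: powr_add)
  also have "(1 / p - 1) * r + (1 - 1 / p) * (r - 1) = 1 / p - 1" by algebra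
  finally have I1: "V powr ((1 / p - 1) * r) * b powr r \<le> 2 powr r * V powr (1 / p - 1) * b" .
  have "c powr r \<le> (2 * V powr (1 - 1 / r) * J powr (1 / r)) powr r"
    using c p by (intro powr_mono2) auto
  also have "\<dots> = 2 powr r * V powr (r - 1) * J"
    using p J by (simp add: powr_mult powr_powr left_diff_distrib)
  finally have "V powr ((1 / p - 1) * r) * c powr r \<le> V powr ((1 / p - 1) * r) * (2 powr r * V powr (r - 1) * J)"
    by (intro mult_left_mono) auto
  also have "\<dots> = 2 powr r * V powr ((1 / p - 1) * r + (r - 1)) * J"
    by (simp add: powr_add)
  also have "(1 / p - 1) * r + (r - 1) = r / p - 1" by (simp add: field_simps)
  finally have I2: "V powr ((1 / p - 1) * r) * c powr r \<le> 2 powr r * V powr (r / p - 1) * J" .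
  have "(V powr (1 / p - 1) * (b + c)) powr r = V powr ((1 / p - 1) * r) * (b + c) powr r"
    using b c by (simp add: powr_mult powr_powr)
  also have "\<dots> \<le> V powr ((1 / p - 1) * r) * (2 powr r * (b powr r + c powr r))"
    using b c p by (intro mult_left_mono powr_add_le) auto
  also have "\<dots> = 2 powr r * (V powr ((1 / p - 1) * r) * b powr r + V powr ((1 / p - 1) * r) * c powr r)"
    by (simp add: algebra_simps)
  also have "\<dots> \<le> 2 powr r * (2 powr r * V powr (1 / p - 1) * b + 2 powr r * V powr (r / p - 1) * J)"
    using I1 I2 by (intro mult_left_mono add_mono) auto
  also have "\<dots> = 2 powr r * 2 powr r * (V powr (1 / p - 1) * b + V powr (r / p - 1) * J)"
    by (simp add: algebra_simps)
  \<comment> \<open>One factor \<open>2 powr r\<close> comes from separating \<open>b + c\<close>,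
    the other from the crude Hoelder inequality.\<close>
  also have "2 powr r * 2 powr r = (4 powr r :: real)" by (simp flip: powr_mult)
  finally have "ennreal ((V powr (1 / p - 1) * (b + c)) powr r)
      \<le> ennreal (4 powr r) * (ennreal (V powr (1 / p - 1)) * ennreal b + ennreal (V powr (r / p - 1)) * ennreal J)"
    using b J by (simp add: ennreal_leI flip: ennreal_mult ennreal_plus)
  also have "ennreal (V powr (1 / p - 1)) * ennreal b =
     (\<integral>\<^sup>+x. ennreal (V powr (1 / p - 1)) * (ennreal (h x) * indicator S x) \<partial>M)"
    unfolding b(1)[symmetric] by (rule nn_integral_cmult[symmetric]) measurable
  also have "\<dots> = (\<integral>\<^sup>+x. ennreal (g x) * (ennreal (V powr (1 / p - 1)) * indicator {x\<in>S. V powr (- 1 / p) < g x} x) \<partial>M)"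
    by (intro nn_integral_cong) (auto simp: h_def l_def indicator_def mult.commute)
  also have "ennreal (V powr (r / p - 1)) * ennreal J =
     (\<integral>\<^sup>+x. ennreal (V powr (r / p - 1)) * (ennreal (k x powr r) * indicator S x) \<partial>M)"
    unfolding J(1)[symmetric] by (rule nn_integral_cmult[symmetric]) measurable
  also have "\<dots> = (\<integral>\<^sup>+x. ennreal (g x powr r) * (ennreal (V powr (r / p - 1)) * indicator {x\<in>S. 0 < g x \<and> g x \<le> V powr (- 1 / p)} x) \<partial>M)"
    using g by (intro nn_integral_cong) (auto simp: k_def l_def indicator_def mult.commute not_less less_le)
  finally show "ennreal ((V powr (1 / p - 1) * enn2real (\<integral>\<^sup>+x\<in>S. ennreal (g x) \<partial>M)) powr r)
      \<le> ennreal (4 powr r)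
          * ((\<integral>\<^sup>+x. ennreal (g x) * (ennreal (V powr (1 / p - 1)) * indicator {x\<in>S. V powr (- 1 / p) < g x} x) \<partial>M)
           + (\<integral>\<^sup>+x. ennreal (g x powr r) * (ennreal (V powr (r / p - 1)) * indicator {x\<in>S. 0 < g x \<and> g x \<le> V powr (- 1 / p)} x) \<partial>M))"
    using b c by (simp add: a del: ennreal_plus)
qed

section \<open>Families of sets graded by levels\<close>

text \<open>In the application \<open>S P\<close> is the triple 3P, \<open>V P\<close> the mass of
  5P, and \<open>M\<close> the measure with density \<sigma>. Growth is asked only of sets with a
  common point, since cubes of different levels that lie far apart need not have comparable
  masses.\<close>

locale level_family =
  fixes M :: "'a measure" and S :: "'i::countable \<Rightarrow> 'a set" and V :: "'i \<Rightarrow> real"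
    and lev :: "'i \<Rightarrow> int" and d :: real and N :: nat
  assumes S_sets: "\<And>P. S P \<in> sets M"
    and V_pos: "\<And>P. V P > 0"
    and S_le: "\<And>P. emeasure M (S P) \<le> ennreal (V P)"
    and d: "d > 1"
    and overlap: "\<And>x k. finite {P. x \<in> S P \<and> lev P = k}" "\<And>x k. card {P. x \<in> S P \<and> lev P = k} \<le> N"
    and growth: "\<And>x P P'. x \<in> S P \<Longrightarrow> x \<in> S P' \<Longrightarrow> lev P < lev P' \<Longrightarrow>
                   d ^ nat (lev P' - lev P) * V P \<le> V P'"
begin

text \<open>All contributing \<open>S P\<close> contain \<open>x\<close>, so \<open>growth\<close>
  compares any two of them at different levels and \<open>overlap\<close> bounds their number per
  level; the lower bound \<open>t\<close> starts the geometric series.\<close>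

lemma sum_large_le:
  assumes b: "b > 0" and t: "t > 0"
  shows "(\<integral>\<^sup>+P. ennreal (V P powr (- b)) * of_bool (x \<in> S P \<and> t < V P) \<partial>count_space UNIV)
    \<le> ennreal (real N / (1 - d powr (- b)) * t powr (- b))"
proof (rule nn_integral_count_space_le)
  fix A :: "'i set" assume A: "finite A"
  let ?A = "{P \<in> A. x \<in> S P \<and> t < V P}"
  have "(\<Sum>P\<in>A. ennreal (V P powr (- b)) * of_bool (x \<in> S P \<and> t < V P))
      = (\<Sum>P\<in>?A. ennreal (V P powr (- b)))"
    using A by (intro sum.mono_neutral_cong_right) auto
  also have "\<dots> = ennreal (\<Sum>P\<in>?A. V P powr (- b))" by simp
  also have "\<dots> \<le> ennreal (real N / (1 - d powr (- b)) * t powr (- b))"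
  proof (intro ennreal_leI sum_geometric_levels_le[where lev = lev])
    fix k
    have "card {P \<in> ?A. lev P = k} \<le> card {P. x \<in> S P \<and> lev P = k}"
      using overlap(1) by (intro card_mono) auto
    also note overlap(2)
    finally show "card {P \<in> ?A. lev P = k} \<le> N" .
  next
    fix P P' assume "P \<in> ?A" "P' \<in> ?A" "lev P < lev P'"
    then show "d ^ nat (lev P' - lev P) * V P \<le> V P'" using growth[of x P P'] by simp
  qed (use A b t d in auto)
  finally show "(\<Sum>P\<in>A. ennreal (V P powr (- b)) * of_bool (x \<in> S P \<and> t < V P))
    \<le> ennreal (real N / (1 - d powr (- b)) * t powr (- b))" .
qed

text \<open>Passing to \<open>1 / V\<close> and \<open>- lev\<close> reverses the growth, so the same geometric sum applies.\<close>

lemma sum_small_le: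
  assumes b: "b > 0" and t: "t > 0"
  shows "(\<integral>\<^sup>+P. ennreal (V P powr b) * of_bool (x \<in> S P \<and> V P \<le> t) \<partial>count_space UNIV)
    \<le> ennreal (real N / (1 - d powr (- b)) * t powr b)"
proof (rule nn_integral_count_space_le)
  fix A :: "'i set" assume A: "finite A"
  let ?A = "{P \<in> A. x \<in> S P \<and> V P \<le> t}"
  have "(\<Sum>P\<in>A. ennreal (V P powr b) * of_bool (x \<in> S P \<and> V P \<le> t))
      = (\<Sum>P\<in>?A. ennreal ((1 / V P) powr (- b)))"
    using A V_pos by (intro sum.mono_neutral_cong_right) (auto simp: powr_minus powr_divide less_imp_le)
  also have "\<dots> = ennreal (\<Sum>P\<in>?A. (1 / V P) powr (- b))" by simp
  also have "\<dots> \<le> ennreal (real N / (1 - d powr (- b)) * (1 / t) powr (- b))"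
  proof (intro ennreal_leI sum_geometric_levels_le[where lev = "\<lambda>P. - lev P"])
    fix k
    have "card {P \<in> ?A. - lev P = k} \<le> card {P. x \<in> S P \<and> lev P = - k}"
      using overlap(1) by (intro card_mono) auto
    also note overlap(2)
    finally show "card {P \<in> ?A. - lev P = k} \<le> N" .
  next
    fix P P' assume "P \<in> ?A" "P' \<in> ?A" "- lev P < - lev P'"
    then show "d ^ nat (- lev P' - - lev P) * (1 / V P) \<le> 1 / V P'"
      using growth[of x P' P] V_pos[of P] V_pos[of P'] by (simp add: field_simps)
  qed (use A b t d V_pos in \<open>auto simp: field_simps\<close>)
  also have "(1 / t) powr (- b) = t powr b" using t by (simp add: powr_minus powr_divide)
  finally show "(\<Sum>P\<in>A. ennreal (V P powr b) * of_bool (x \<in> S P \<and> V P \<le> t))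
    \<le> ennreal (real N / (1 - d powr (- b)) * t powr b)" .
qed

text \<open>After the split bound for each \<open>P\<close>, Tonelli's theorem reduces the claim to
  two sums over the sets containing a fixed \<open>x\<close>, one over large and one over small
  \<open>V P\<close>. Each is geometric, and its value at the threshold
  \<open>g x powr (- p)\<close> turns the integrand into a multiple of
  \<open>g x powr p\<close>.\<close>

lemma embedding:
  assumes p: "1 < p" "p < r"
  obtains C :: real where "C \<ge> 0"
    "\<And>g. g \<in> borel_measurable M \<Longrightarrow> (\<And>x. g x \<ge> 0) \<Longrightarrow>
        (\<integral>\<^sup>+x. ennreal (g x powr p) \<partial>M) \<le> 1 \<Longrightarrow>
        (\<integral>\<^sup>+P. ennreal ((V P powr (1 / p - 1) * enn2real (\<integral>\<^sup>+x\<in>S P. ennreal (g x) \<partial>M)) powr r)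
            \<partial>count_space UNIV) \<le> ennreal C"
proof -
  define C1 where "C1 = real N / (1 - d powr (- (1 - 1 / p)))"
  define C2 where "C2 = real N / (1 - d powr (- (r / p - 1)))"
  have C: "C1 \<ge> 0" "C2 \<ge> 0"
    using d p powr_less_one[of d "- (1 - 1 / p)"] powr_less_one[of d "- (r / p - 1)"]
    by (auto simp: C1_def C2_def field_simps intro!: divide_nonneg_nonneg)
  show ?thesis
  proof (rule that[of "4 powr r * (C1 + C2)"])
    fix g :: "'a \<Rightarrow> real"
    assume [measurable]: "g \<in> borel_measurable M" and g: "\<And>x. g x \<ge> 0"
      and g1: "(\<integral>\<^sup>+x. ennreal (g x powr p) \<partial>M) \<le> 1"
    note [measurable] = S_sets
    let ?L = "\<lambda>P x. ennreal (V P powr (1 / p - 1)) * indicator {x\<in>S P. V P powr (- 1 / p) < g x} x :: ennreal"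
    let ?U = "\<lambda>P x. ennreal (V P powr (r / p - 1)) * indicator {x\<in>S P. 0 < g x \<and> g x \<le> V P powr (- 1 / p)} x :: ennreal"
    have [measurable]: "?L P \<in> borel_measurable M" "?U P \<in> borel_measurable M" for P
    proof -
      have "{x\<in>S P. V P powr (- 1 / p) < g x} = {x\<in>space M. x \<in> S P \<and> V P powr (- 1 / p) < g x}"
        "{x\<in>S P. 0 < g x \<and> g x \<le> V P powr (- 1 / p)} = {x\<in>space M. x \<in> S P \<and> 0 < g x \<and> g x \<le> V P powr (- 1 / p)}"
        using sets.sets_into_space[OF S_sets] by auto
      then have [measurable]: "{x\<in>S P. V P powr (- 1 / p) < g x} \<in> sets M"
        "{x\<in>S P. 0 < g x \<and> g x \<le> V P powr (- 1 / p)} \<in> sets M" by simp_all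
      show "?L P \<in> borel_measurable M" "?U P \<in> borel_measurable M" by measurable
    qed
    \<comment> \<open>A cut of \<open>g\<close> at a height depending on \<open>P\<close> becomes a
      cut of \<open>V P\<close> at a threshold depending only on the value of \<open>g\<close>; the
      negative exponent reverses the inequality.\<close>
    have thr: "V P powr (- 1 / p) < y \<longleftrightarrow> y powr (- p) < V P" if "y > 0" for y P
    proof -
      have "V P powr (- 1 / p) < y \<longleftrightarrow> y powr (- p) < (V P powr (- 1 / p)) powr (- p)"
        using p that V_pos[of P] powr_less_mono2_neg[of "- p" "V P powr (- 1 / p)" y]
          powr_mono2'[of "- p" y "V P powr (- 1 / p)"]
        by (auto simp: not_less[symmetric])
      also have "(V P powr (- 1 / p)) powr (- p) = V P"
        using p V_pos[of P] by (simp add: powr_powr)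
      finally show ?thesis .
    qed
    \<comment> \<open>Upper part: with \<open>b = 1 - 1 / p\<close> the sum over \<open>V P\<close>
      above the threshold contributes \<open>g x powr (p - 1)\<close>, and the factor
      \<open>g x\<close> completes the power \<open>p\<close>.\<close>
    have 1: "ennreal (g x) * (\<integral>\<^sup>+P. ?L P x \<partial>count_space UNIV) \<le> ennreal C1 * ennreal (g x powr p)" for x
    proof (cases "g x = 0")
      case False
      then have gx: "g x > 0" using g[of x] by simp
      have "(\<integral>\<^sup>+P. ?L P x \<partial>count_space UNIV)
          = (\<integral>\<^sup>+P. ennreal (V P powr (- (1 - 1 / p))) * of_bool (x \<in> S P \<and> g x powr (- p) < V P) \<partial>count_space UNIV)"
        using thr[OF gx] by (intro nn_integral_cong) (auto simp: indicator_def)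
      also have "\<dots> \<le> ennreal (C1 * (g x powr (- p)) powr (- (1 - 1 / p)))"
        unfolding C1_def by (rule sum_large_le) (use p gx in \<open>auto simp: field_simps\<close>)
      finally have "ennreal (g x) * (\<integral>\<^sup>+P. ?L P x \<partial>count_space UNIV)
         \<le> ennreal (g x) * ennreal (C1 * (g x powr (- p)) powr (- (1 - 1 / p)))"
        by (rule mult_left_mono) simp
      also have "\<dots> = ennreal (C1 * (g x powr 1 * (g x powr (- p)) powr (- (1 - 1 / p))))"
        using gx C by (simp add: mult_ac flip: ennreal_mult)
      also have "g x powr 1 * (g x powr (- p)) powr (- (1 - 1 / p)) = g x powr p"
        unfolding powr_powr powr_add[symmetric] using p by (simp add: field_simps)
      finally show ?thesis using C by (simp add: ennreal_mult)
    qed simp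
    \<comment> \<open>Lower part: here \<open>b = r / p - 1\<close>, positive because
      \<open>p < r\<close>, and the exponents of \<open>g x\<close> add up to
      \<open>r - (r - p) = p\<close>.\<close>
    have 2: "ennreal (g x powr r) * (\<integral>\<^sup>+P. ?U P x \<partial>count_space UNIV) \<le> ennreal C2 * ennreal (g x powr p)" for x
    proof (cases "g x = 0")
      case False
      then have gx: "g x > 0" using g[of x] by simp
      have "(\<integral>\<^sup>+P. ?U P x \<partial>count_space UNIV)
          = (\<integral>\<^sup>+P. ennreal (V P powr (r / p - 1)) * of_bool (x \<in> S P \<and> V P \<le> g x powr (- p)) \<partial>count_space UNIV)"
        using thr[OF gx] gx by (intro nn_integral_cong) (auto simp: indicator_def not_less[symmetric])
      also have "\<dots> \<le> ennreal (C2 * (g x powr (- p)) powr (r / p - 1))"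
        unfolding C2_def by (rule sum_small_le) (use p gx in \<open>auto simp: field_simps\<close>)
      finally have "ennreal (g x powr r) * (\<integral>\<^sup>+P. ?U P x \<partial>count_space UNIV)
         \<le> ennreal (g x powr r) * ennreal (C2 * (g x powr (- p)) powr (r / p - 1))"
        by (rule mult_left_mono) simp
      also have "\<dots> = ennreal (C2 * (g x powr r * (g x powr (- p)) powr (r / p - 1)))"
        using gx C by (simp add: mult_ac flip: ennreal_mult)
      also have "g x powr r * (g x powr (- p)) powr (r / p - 1) = g x powr p"
        unfolding powr_powr powr_add[symmetric] using p by (simp add: field_simps)
      finally show ?thesis using C by (simp add: ennreal_mult)
    qed simp
    have "(\<integral>\<^sup>+P. ennreal ((V P powr (1 / p - 1) * enn2real (\<integral>\<^sup>+x\<in>S P. ennreal (g x) \<partial>M)) powr r) \<partial>count_space UNIV)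
      \<le> (\<integral>\<^sup>+P. ennreal (4 powr r) * ((\<integral>\<^sup>+x. ennreal (g x) * ?L P x \<partial>M)
            + (\<integral>\<^sup>+x. ennreal (g x powr r) * ?U P x \<partial>M)) \<partial>count_space UNIV)"
      by (intro nn_integral_mono nn_integral_split_bound(2)) (use p V_pos S_le g g1 in auto)
    also have "\<dots> = ennreal (4 powr r) * ((\<integral>\<^sup>+P. \<integral>\<^sup>+x. ennreal (g x) * ?L P x \<partial>M \<partial>count_space UNIV)
          + (\<integral>\<^sup>+P. \<integral>\<^sup>+x. ennreal (g x powr r) * ?U P x \<partial>M \<partial>count_space UNIV))"
      by (simp add: nn_integral_cmult nn_integral_add)
    also have "(\<integral>\<^sup>+P. \<integral>\<^sup>+x. ennreal (g x) * ?L P x \<partial>M \<partial>count_space UNIV)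
        = (\<integral>\<^sup>+x. \<integral>\<^sup>+P. ennreal (g x) * ?L P x \<partial>count_space UNIV \<partial>M)"
      by (rule nn_integral_count_space_nn_integral[symmetric]) auto
    also have "\<dots> = (\<integral>\<^sup>+x. ennreal (g x) * (\<integral>\<^sup>+P. ?L P x \<partial>count_space UNIV) \<partial>M)"
      by (simp add: nn_integral_cmult)
    also have "\<dots> \<le> (\<integral>\<^sup>+x. ennreal C1 * ennreal (g x powr p) \<partial>M)" by (intro nn_integral_mono 1)
    also have "\<dots> = ennreal C1 * (\<integral>\<^sup>+x. ennreal (g x powr p) \<partial>M)" by (simp add: nn_integral_cmult)
    also have "\<dots> \<le> ennreal C1 * 1" by (intro mult_left_mono g1) simp
    also have "(\<integral>\<^sup>+P. \<integral>\<^sup>+x. ennreal (g x powr r) * ?U P x \<partial>M \<partial>count_space UNIV)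
        = (\<integral>\<^sup>+x. \<integral>\<^sup>+P. ennreal (g x powr r) * ?U P x \<partial>count_space UNIV \<partial>M)"
      by (rule nn_integral_count_space_nn_integral[symmetric]) auto
    also have "\<dots> = (\<integral>\<^sup>+x. ennreal (g x powr r) * (\<integral>\<^sup>+P. ?U P x \<partial>count_space UNIV) \<partial>M)"
      by (simp add: nn_integral_cmult)
    also have "\<dots> \<le> (\<integral>\<^sup>+x. ennreal C2 * ennreal (g x powr p) \<partial>M)" by (intro nn_integral_mono 2)
    also have "\<dots> = ennreal C2 * (\<integral>\<^sup>+x. ennreal (g x powr p) \<partial>M)" by (simp add: nn_integral_cmult)
    also have "\<dots> \<le> ennreal C2 * 1" by (intro mult_left_mono g1) simp
    finally show "(\<integral>\<^sup>+P. ennreal ((V P powr (1 / p - 1) * enn2real (\<integral>\<^sup>+x\<in>S P. ennreal (g x) \<partial>M)) powr r) \<partial>count_space UNIV)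
      \<le> ennreal (4 powr r * (C1 + C2))"
      using C by (simp add: ennreal_mult mult_left_mono)
  qed (use C in auto)
qed

end

section \<open>Cubes and reverse doubling\<close>

lemma mem_cube: "x \<in> cube a h \<longleftrightarrow> (\<forall>i. a $ i \<le> x $ i \<and> x $ i \<le> a $ i + h)"
  by (simp add: cube_def mem_box_cart)

lemma cube_sets [measurable]: "cube a h \<in> sets lebesgue"
  by (simp add: cube_def)

lemma cube_in_cubes: "h > 0 \<Longrightarrow> cube a h \<in> cubes"
  by (auto simp: cubes_def)

lemma measure_cube:
  assumes "h > 0"
  shows "measure lebesgue (cube (a :: real ^ 'n) h) = h ^ CARD('n)"
proof -
  have "a \<in> cube a h" using assms by (simp add: mem_cube)
  then have "cbox a (\<chi> i. a $ i + h) \<noteq> {}" by (auto simp: cube_def)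
  then show ?thesis by (simp add: cube_def content_cbox_cart)
qed

lemma emeasure_cube:
  assumes "h > 0"
  shows "emeasure lebesgue (cube (a :: real ^ 'n) h) = ennreal (h ^ CARD('n))"
  using measure_cube[OF assms, of a] emeasure_eq_ennreal_measure[of lebesgue "cube a h"]
  by (simp add: cube_def emeasure_lborel_cbox_eq)

lemma weighted_measure_mono: "E \<subseteq> F \<Longrightarrow> weighted_measure \<rho> E \<le> weighted_measure \<rho> F"
  unfolding weighted_measure_def by (intro nn_integral_mono) (auto simp: indicator_def)

text \<open>An a.e. positive function with integral 0 over a cube would make the cube a null set.
  Positivity of the masses is what allows negative powers of them later.\<close>

lemma weighted_measure_cube_pos:
  fixes \<rho> :: "real ^ 'n \<Rightarrow> real"
  assumes [measurable]: "\<rho> \<in> borel_measurable lebesgue"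
    and pos: "AE x in lebesgue. \<rho> x > 0" and h: "h > 0"
  shows "weighted_measure \<rho> (cube a h) > 0"
proof (rule ccontr)
  assume "\<not> ?thesis"
  then have "(\<integral>\<^sup>+x\<in>cube a h. ennreal (\<rho> x) \<partial>lebesgue) = 0"
    by (simp add: weighted_measure_def)
  then have "AE x in lebesgue. ennreal (\<rho> x) * indicator (cube a h) x = 0"
    by (subst (asm) nn_integral_0_iff_AE) auto
  with pos have "AE x in lebesgue. x \<notin> cube a h"
    by eventually_elim (auto simp: indicator_def split: if_splits)
  then have "emeasure lebesgue (cube a h) = 0"
    by (subst (asm) AE_iff_measurable[OF cube_sets[of a h]]) auto
  then have "h ^ CARD('n) \<le> 0"
    unfolding emeasure_cube[OF h] by (simp add: ennreal_eq_0_iff)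
  then show False using zero_less_power[OF h, of "CARD('n)"] by linarith
qed

lemma weighted_measure_cube_finite:
  assumes "weight \<rho>"
  shows "weighted_measure \<rho> (cube a h) < \<infinity>"
proof -
  have "set_integrable lebesgue (cube a h) \<rho>"
    using assms by (auto simp: weight_def cube_def)
  then have "(\<integral>\<^sup>+x. ennreal (norm (indicator (cube a h) x *\<^sub>R \<rho> x)) \<partial>lebesgue) < \<infinity>"
    unfolding set_integrable_def integrable_iff_bounded by simp
  moreover have "weighted_measure \<rho> (cube a h) \<le> (\<integral>\<^sup>+x. ennreal (norm (indicator (cube a h) x *\<^sub>R \<rho> x)) \<partial>lebesgue)"
    unfolding weighted_measure_def
    by (intro nn_integral_mono) (auto simp: indicator_def intro!: ennreal_leI)
  ultimately show ?thesis by order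
qed

abbreviation centered :: "real ^ 'n \<Rightarrow> real \<Rightarrow> (real ^ 'n) set" where
  "centered y h \<equiv> cube (\<chi> i. y $ i - h) (2 * h)"

text \<open>The concentric triple of a cube contains a cube of twice the side with the given cube at
  its lower corner; so only the subcube with \<open>e = 0\<close> is needed.\<close>

lemma reverse_doubling_centered:
  fixes \<rho> :: "real ^ 'n \<Rightarrow> real"
  assumes "reverse_doubling \<rho>"
  obtains d :: real where "d > 1"
    "\<And>y h. h > 0 \<Longrightarrow> ennreal d * weighted_measure \<rho> (centered y h) \<le> weighted_measure \<rho> (centered y (3 * h))"
proof -
  obtain d where d: "d > 1" and rd: "\<And>a h e. h > 0 \<Longrightarrow> (\<forall>i. e $ i \<in> {0, 1}) \<Longrightarrow>
       ennreal d * weighted_measure \<rho> (cube (a + (h / 2) *\<^sub>R e) (h / 2)) \<le> weighted_measure \<rho> (cube a h)"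
    using assms unfolding reverse_doubling_def by blast
  show ?thesis
  proof (rule that[OF d])
    fix y :: "real ^ 'n" and h :: real assume h: "h > 0"
    have "ennreal d * weighted_measure \<rho> (centered y h) \<le> weighted_measure \<rho> (cube (\<chi> i. y $ i - h) (4 * h))"
      using rd[of "4 * h" 0 "\<chi> i. y $ i - h"] h by simp
    also have "\<dots> \<le> weighted_measure \<rho> (centered y (3 * h))"
      using h by (intro weighted_measure_mono) (auto simp: mem_cube, smt+)
    finally show "ennreal d * weighted_measure \<rho> (centered y h) \<le> weighted_measure \<rho> (centered y (3 * h))" .
  qed
qed

section \<open>Grids of cubes with side a power of 12, and their dilates\<close>

text \<open>The ratio \<open>12 = 3 * 4\<close> is chosen so that \<open>5P\<close>, being contained in the cube \<open>Q\<close> of half-side \<open>4 *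
  level_side k\<close> around any \<open>y \<in> 3P\<close>, satisfies \<open>3Q \<subseteq> 5P'\<close> for \<open>P'\<close> one level up with \<open>y \<in> 3P'\<close>.\<close>

definition level_side :: "int \<Rightarrow> real" where
  "level_side k = 12 powr real_of_int k"

text \<open>\<open>P = (k, j)\<close> stands for the grid cube with lower corner \<open>level_side k * j\<close>, and \<open>grid_cube c P\<close> for its
  concentric dilate by the factor \<open>2 * c + 1\<close>.\<close>

definition grid_cube :: "real \<Rightarrow> int \<times> (int ^ 'n) \<Rightarrow> (real ^ 'n) set" where
  "grid_cube c P = cube (\<chi> i. level_side (fst P) * (real_of_int (snd P $ i) - c)) ((2 * c + 1) * level_side (fst P))"

lemma level_side_pos: "level_side k > 0"
  by (simp add: level_side_def)

lemma level_side_Suc: "level_side (k + 1) = 12 * level_side k"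
  by (simp add: level_side_def powr_add)

lemma mem_grid_cube:
  "x \<in> grid_cube c P \<longleftrightarrow> (\<forall>i. real_of_int (snd P $ i) - c \<le> x $ i / level_side (fst P) \<and>
     x $ i / level_side (fst P) \<le> real_of_int (snd P $ i) + c + 1)"
  using level_side_pos[of "fst P"] by (simp add: grid_cube_def mem_cube field_simps)

lemma grid_cube_mono:
  assumes "b \<le> c"
  shows "grid_cube b P \<subseteq> grid_cube c P"
proof
  fix x assume "x \<in> grid_cube b P"
  then have "\<And>i. snd P $ i - b \<le> x $ i / level_side (fst P) \<and> x $ i / level_side (fst P) \<le> snd P $ i + b + 1"
    by (simp add: mem_grid_cube)
  with assms show "x \<in> grid_cube c P"
    unfolding mem_grid_cube by (smt (verit))
qed

lemma grid_cube_sets [measurable]: "grid_cube c P \<in> sets lebesgue"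
  by (simp add: grid_cube_def)

text \<open>The level is the least one whose side is at least \<open>h\<close>, and \<open>P\<close>
  is found by rounding down the coordinates of \<open>x\<close>. Points of the given cube differ
  from \<open>x\<close> by at most \<open>h\<close>, hence by at most one grid side, in each
  coordinate, so they stay in the triple of \<open>P\<close>. Minimality of the level gives the
  bound \<open>12 * h\<close>.\<close>

lemma cube_subset_grid_cube:
  fixes a x :: "real ^ 'n"
  assumes h: "h > 0" and x: "x \<in> cube a h"
  obtains P :: "int \<times> (int ^ 'n)" where "x \<in> grid_cube 0 P" "cube a h \<subseteq> grid_cube 1 P" "level_side (fst P) \<le> 12 * h"
proof -
  define k where "k = \<lceil>log 12 h\<rceil>"
  have "log 12 h \<le> k" "k - 1 \<le> log 12 h" unfolding k_def by linarith+
  then have k: "h \<le> level_side k" "level_side k / 12 \<le> h"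
    using h by (auto simp: level_side_def log_le_iff le_log_iff powr_diff)
  define j :: "int ^ 'n" where "j = (\<chi> i. \<lfloor>x $ i / level_side k\<rfloor>)"
  have j: "real_of_int (j $ i) \<le> x $ i / level_side k" "x $ i / level_side k \<le> real_of_int (j $ i) + 1" for i
    unfolding j_def by simp_all
  have hk: "h / level_side k \<le> 1" using k level_side_pos[of k] by simp
  show ?thesis
  proof (rule that[of "(k, j)"])
    show "x \<in> grid_cube 0 (k, j)" using j by (simp add: mem_grid_cube)
    show "cube a h \<subseteq> grid_cube 1 (k, j)"
    proof
      fix y assume y: "y \<in> cube a h"
      have "\<bar>y $ i - x $ i\<bar> \<le> h" for i using x y by (simp add: mem_cube) (smt (verit))
      then have "\<bar>y $ i / level_side k - x $ i / level_side k\<bar> \<le> 1" for i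
        using hk level_side_pos[of k] k(1) by (simp add: diff_divide_distrib[symmetric] abs_divide)
          (meson order_trans)
      then show "y \<in> grid_cube 1 (k, j)"
        using j unfolding mem_grid_cube fst_conv snd_conv by (smt (verit))
    qed
    show "level_side (fst (k, j)) \<le> 12 * h" using k by simp
  qed
qed

text \<open>In units of the grid side, the corner of a grid cube whose triple contains
  \<open>x\<close> differs from the rounded-down \<open>x\<close> by -2, -1, 0 or 1 in each
  coordinate; -2 arises only when \<open>x\<close> lies on a closed upper face of the triple. The
  resulting bound depends neither on \<open>x\<close> nor on the level.\<close>

lemma grid_cube_overlap:
  fixes x :: "real ^ 'n"
  shows "finite {P. x \<in> grid_cube 1 P \<and> fst P = k}" (is "finite ?A")
    and "card {P. x \<in> grid_cube 1 P \<and> fst P = k} \<le> card {v :: int ^ 'n. \<forall>i. v $ i \<in> {-2..1}}"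
proof -
  let ?B = "{v :: int ^ 'n. \<forall>i. v $ i \<in> {-2..1}}"
  have "?B \<subseteq> vec_lambda ` (PiE UNIV (\<lambda>_. {-2..1}))"
  proof
    fix v :: "int ^ 'n" assume "v \<in> ?B"
    then show "v \<in> vec_lambda ` (PiE UNIV (\<lambda>_. {-2..1}))"
      by (intro image_eqI[of _ _ "vec_nth v"]) auto
  qed
  then have B: "finite ?B" by (rule finite_subset) (auto intro!: finite_PiE)
  let ?f = "\<lambda>P :: int \<times> (int ^ 'n). \<chi> i. snd P $ i - \<lfloor>x $ i / level_side k\<rfloor>"
  have inj: "inj_on ?f ?A"
    by (rule inj_onI) (auto simp: vec_eq_iff prod_eq_iff)
  have im: "?f ` ?A \<subseteq> ?B"
  proof -
    have "?f P $ i \<in> {-2..1}" if "P \<in> ?A" for P i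
    proof -
      have "snd P $ i - 1 \<le> x $ i / level_side k" "x $ i / level_side k \<le> snd P $ i + 2"
        using that by (auto simp: mem_grid_cube add.commute)
      then show ?thesis by simp linarith
    qed
    then show ?thesis by blast
  qed
  show "finite ?A" using finite_subset[OF im B] inj by (rule finite_imageD)
  show "card ?A \<le> card ?B" using card_inj_on_le[OF inj im B] .
qed

text \<open>In each coordinate, a point of 3P is at least one and at most four grid sides away from
  either end of 5P. Dilates of different grid cubes can thus be compared through cubes with one
  common centre.\<close>

lemma centered_subset_grid_cube:
  assumes "y \<in> grid_cube 1 P"
  shows "centered y (level_side (fst P)) \<subseteq> grid_cube 2 P"
    and "grid_cube 2 P \<subseteq> centered y (4 * level_side (fst P))"
proof -
  define s where "s = level_side (fst P)"
  have s: "s > 0" by (simp add: s_def level_side_pos)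
  have y: "s * snd P $ i - s \<le> y $ i" "y $ i \<le> s * snd P $ i + 2 * s" for i
    using assms by (simp_all add: grid_cube_def mem_cube s_def[symmetric] algebra_simps)
  show "centered y (level_side (fst P)) \<subseteq> grid_cube 2 P"
    using y unfolding subset_iff grid_cube_def mem_cube s_def[symmetric]
    by (simp add: algebra_simps) (smt (verit))
  show "grid_cube 2 P \<subseteq> centered y (4 * level_side (fst P))"
    using y s unfolding subset_iff grid_cube_def mem_cube s_def[symmetric]
    by (simp add: algebra_simps) (smt (verit))
qed

text \<open>A real number, so that \<open>powr\<close> applies; for a weight the mass is finite. The
  dilate is 5P rather than 3P because it contains a cube of fixed proportion about every point of
  3P, as the growth estimate requires.\<close>

definition cube_mass :: "(real ^ 'n \<Rightarrow> real) \<Rightarrow> int \<times> (int ^ 'n) \<Rightarrow> real" where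
  "cube_mass \<rho> P = enn2real (weighted_measure \<rho> (grid_cube 2 P))"

lemma grid_cube_cube: "grid_cube 2 P \<in> cubes"
  unfolding grid_cube_def using level_side_pos[of "fst P"] by (intro cube_in_cubes) simp

lemma cube_mass:
  assumes "weight \<rho>"
  shows "weighted_measure \<rho> (grid_cube 2 P) = ennreal (cube_mass \<rho> P)" "cube_mass \<rho> P > 0"
proof -
  have "weighted_measure \<rho> (grid_cube 2 P) < \<infinity>" "weighted_measure \<rho> (grid_cube 2 P) > 0"
    unfolding grid_cube_def using assms[unfolded weight_def] level_side_pos[of "fst P"]
    by (intro weighted_measure_cube_finite[OF assms] weighted_measure_cube_pos; simp)+
  then show "weighted_measure \<rho> (grid_cube 2 P) = ennreal (cube_mass \<rho> P)" "cube_mass \<rho> P > 0"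
    by (auto simp: cube_mass_def enn2real_positive_iff)
qed

text \<open>Growth is seen from a common point \<open>y\<close> of the two triples. At level
  \<open>k\<close>, 5P lies in the cube of half-side \<open>4 * level_side k\<close> about
  \<open>y\<close>; tripling this half-side gains a factor \<open>d\<close> and gives exactly
  \<open>level_side (k + 1)\<close>. Iteration reaches the level of \<open>P'\<close>, where the
  cube of half-side \<open>level_side (fst P')\<close> about \<open>y\<close> lies in 5P'.\<close>

lemma reverse_doubling_level_family:
  fixes \<rho> :: "real ^ 'n \<Rightarrow> real"
  assumes rd: "reverse_doubling \<rho>"
  obtains d N where
    "level_family (density lebesgue (\<lambda>x. ennreal (\<rho> x))) (grid_cube 1) (cube_mass \<rho>) fst d N"
proof -
  have w: "weight \<rho>" using rd by (simp add: reverse_doubling_def)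
  then have [measurable]: "\<rho> \<in> borel_measurable lebesgue" by (simp add: weight_def)
  obtain d where d: "d > 1"
    and step: "\<And>y h. h > 0 \<Longrightarrow> ennreal d * weighted_measure \<rho> (centered y h) \<le> weighted_measure \<rho> (centered y (3 * h))"
    using reverse_doubling_centered[OF rd] by metis
  have growth: "d ^ nat (fst P' - fst P) * cube_mass \<rho> P \<le> cube_mass \<rho> P'"
    if y: "y \<in> grid_cube 1 P" "y \<in> grid_cube 1 P'" and less: "fst P < fst P'" for y P P'
  proof -
    let ?W = "\<lambda>h. weighted_measure \<rho> (centered y h)"
    have step': "ennreal d * ?W (4 * level_side k) \<le> ?W (level_side (k + 1))" for k
      using step[of "4 * level_side k" y] level_side_pos[of k] by (simp add: level_side_Suc)
    have chain: "ennreal d ^ Suc j * ?W (4 * level_side k) \<le> ?W (level_side (k + int (Suc j)))" for j k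
    proof (induction j)
      case 0
      then show ?case using step' by simp
    next
      case (Suc j)
      have "ennreal d ^ Suc (Suc j) * ?W (4 * level_side k) \<le> ennreal d * ?W (level_side (k + int (Suc j)))"
        using mult_left_mono[OF Suc.IH, of "ennreal d"] by (simp add: mult.assoc)
      also have "?W (level_side (k + int (Suc j))) \<le> ?W (4 * level_side (k + int (Suc j)))"
        using level_side_pos[of "k + int (Suc j)"]
        by (intro weighted_measure_mono) (auto simp: mem_cube, smt+)
      also have "ennreal d * ?W (4 * level_side (k + int (Suc j))) \<le> ?W (level_side (k + int (Suc j) + 1))"
        by (rule step')
      finally show ?case by (simp add: mult_left_mono add_ac)
    qed
    obtain j where j: "fst P' = fst P + int (Suc j)"
      using less zless_iff_Suc_zadd by auto
    have "ennreal d ^ Suc j * weighted_measure \<rho> (grid_cube 2 P) \<le> ennreal d ^ Suc j * ?W (4 * level_side (fst P))"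
      by (intro mult_left_mono weighted_measure_mono centered_subset_grid_cube y) simp
    also have "\<dots> \<le> ?W (level_side (fst P'))" unfolding j by (rule chain)
    also have "\<dots> \<le> weighted_measure \<rho> (grid_cube 2 P')"
      by (intro weighted_measure_mono centered_subset_grid_cube y)
    finally have "d ^ Suc j * cube_mass \<rho> P \<le> cube_mass \<rho> P'"
      using d cube_mass[OF w] less_imp_le[OF cube_mass(2)[OF w]]
      by (simp add: ennreal_power ennreal_mult[symmetric] del: power_Suc)
    moreover have "nat (fst P' - fst P) = Suc j" using j by simp
    ultimately show ?thesis by simp
  qed
  have le: "emeasure (density lebesgue (\<lambda>x. ennreal (\<rho> x))) (grid_cube 1 P) \<le> ennreal (cube_mass \<rho> P)" for P
  proof -
    have "emeasure (density lebesgue (\<lambda>x. ennreal (\<rho> x))) (grid_cube 1 P) = weighted_measure \<rho> (grid_cube 1 P)"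
      by (simp add: emeasure_density weighted_measure_def)
    also have "\<dots> \<le> weighted_measure \<rho> (grid_cube 2 P)"
      by (intro weighted_measure_mono grid_cube_mono) simp
    finally show ?thesis by (simp add: cube_mass[OF w])
  qed
  have "level_family (density lebesgue (\<lambda>x. ennreal (\<rho> x))) (grid_cube 1) (cube_mass \<rho>) fst d
      (card {v :: int ^ 'n. \<forall>i. v $ i \<in> {-2..1}})"
    by unfold_locales (use d le growth cube_mass[OF w] grid_cube_overlap in auto)
  then show ?thesis using that by blast
qed

section \<open>The two-weight inequality\<close>

lemma prod_mono_ennreal:
  fixes f g :: "'i \<Rightarrow> ennreal"
  assumes "\<And>i. i \<in> I \<Longrightarrow> f i \<le> g i"
  shows "(\<Prod>i\<in>I. f i) \<le> (\<Prod>i\<in>I. g i)"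
  using assms by (induction I rule: infinite_finite_induct) (auto intro!: mult_mono)

lemma epowr_ennreal: "a \<ge> 0 \<Longrightarrow> ennreal a epowr r = ennreal (a powr r)"
  by (simp add: epowr_def)

lemma epowr_top [simp]: "top epowr r = top"
  by (simp_all add: epowr_def)

lemma epowr_zero [simp]: "0 epowr r = 0"
  by (simp add: epowr_def)

lemma epowr_mono:
  assumes "a \<le> b" "r \<ge> 0"
  shows "a epowr r \<le> b epowr r"
  using assms
  by (cases a; cases b) (auto simp: epowr_ennreal top_unique intro!: ennreal_leI powr_mono2)

text \<open>In the infinite case both sides follow the convention that 0 times \<infinity> is 0: the
  power keeps 0 and \<infinity> fixed, and a nonzero factor has a nonzero power.\<close>

lemma epowr_mult: "(a * b) epowr r = a epowr r * b epowr r"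
proof (cases "a = \<infinity> \<or> b = \<infinity>")
  case True
  have "x = 0 \<or> x epowr r > 0" for x
    by (cases x) (auto simp: epowr_ennreal)
  with True show ?thesis
    by (auto simp: ennreal_top_mult ennreal_mult_top) (metis less_numeral_extra(3))+
next
  case False
  then show ?thesis
    by (cases a; cases b) (auto simp: epowr_ennreal powr_mult simp flip: ennreal_mult)
qed

lemma epowr_inverse:
  assumes "r > 0"
  shows "(a epowr r) epowr (1 / r) = a" "(a epowr (1 / r)) epowr r = a"
  using assms by (cases a; simp add: epowr_ennreal powr_powr)+

lemma conj_exponent:
  assumes "p > 1"
  shows "1 / conj_exponent p = 1 - 1 / p" "conj_exponent p * (p - 1) = p"
  using assms by (auto simp: conj_exponent_def field_simps)

section \<open>The embedding for a dual weight\<close>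

text \<open>With \<sigma> the dual weight and p' the conjugate exponent, the embedding is applied to
  g = |f| / (N \<sigma>). Since p' (p - 1) = p, the integral of the p-th power of g against \<sigma>
  is that of the p-th power of |w f| / N, hence at most 1, while the integral of g against \<sigma>
  over 3P is that of |f| / N. Thus \<open>N\<close> is a bound for the norm of w f.\<close>

lemma reverse_doubling_embedding:
  fixes w :: "real ^ 'n \<Rightarrow> real"
  assumes w [measurable]: "w \<in> borel_measurable lebesgue" and pos: "AE x in lebesgue. w x > 0"
    and p: "1 < p" "p < r"
    and rd: "reverse_doubling (\<lambda>x. w x powr (- conj_exponent p))"
  obtains C :: real where "C \<ge> 0"
    "\<And>f N P. f \<in> borel_measurable lebesgue \<Longrightarrow> N > 0 \<Longrightarrow>
        (\<integral>\<^sup>+x. ennreal (\<bar>w x * f x\<bar> powr p) \<partial>lebesgue) \<le> ennreal (N powr p) \<Longrightarrow>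
        (\<integral>\<^sup>+x\<in>grid_cube 1 P. ennreal \<bar>f x\<bar> \<partial>lebesgue) < \<infinity>"
    "\<And>f N. f \<in> borel_measurable lebesgue \<Longrightarrow> N > 0 \<Longrightarrow>
        (\<integral>\<^sup>+x. ennreal (\<bar>w x * f x\<bar> powr p) \<partial>lebesgue) \<le> ennreal (N powr p) \<Longrightarrow>
        (\<integral>\<^sup>+P. ennreal ((cube_mass (\<lambda>x. w x powr (- conj_exponent p)) P powr (1 / p - 1)
                * enn2real (\<integral>\<^sup>+x\<in>grid_cube 1 P. ennreal \<bar>f x\<bar> \<partial>lebesgue) / N) powr r)
            \<partial>count_space UNIV) \<le> ennreal C"
proof -
  let ?\<sigma> = "\<lambda>x. w x powr (- conj_exponent p)"
  let ?M = "density lebesgue (\<lambda>x. ennreal (?\<sigma> x))"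
  obtain d N where "level_family ?M (grid_cube 1) (cube_mass ?\<sigma>) fst d N"
    using reverse_doubling_level_family[OF rd] .
  then interpret level_family ?M "grid_cube 1" "cube_mass ?\<sigma>" fst d N .
  obtain C where C: "C \<ge> 0" and emb: "\<And>g. g \<in> borel_measurable ?M \<Longrightarrow> (\<And>x. g x \<ge> 0) \<Longrightarrow>
        (\<integral>\<^sup>+x. ennreal (g x powr p) \<partial>?M) \<le> 1 \<Longrightarrow>
        (\<integral>\<^sup>+P. ennreal ((cube_mass ?\<sigma> P powr (1 / p - 1)
            * enn2real (\<integral>\<^sup>+x\<in>grid_cube 1 P. ennreal (g x) \<partial>?M)) powr r) \<partial>count_space UNIV) \<le> ennreal C"
    using embedding[OF p] by blast
  define G where "G f N x = \<bar>f x\<bar> * w x powr conj_exponent p / N" for f :: "real ^ 'n \<Rightarrow> real" and N x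
  have G: "G f N \<in> borel_measurable ?M" "\<And>x. G f N x \<ge> 0" "(\<integral>\<^sup>+x. ennreal (G f N x powr p) \<partial>?M) \<le> 1"
    "\<And>P. (\<integral>\<^sup>+x\<in>grid_cube 1 P. ennreal (G f N x) \<partial>?M)
       = ennreal (1 / N) * (\<integral>\<^sup>+x\<in>grid_cube 1 P. ennreal \<bar>f x\<bar> \<partial>lebesgue)"
    if [measurable]: "f \<in> borel_measurable lebesgue" and N: "N > 0"
      and norm: "(\<integral>\<^sup>+x. ennreal (\<bar>w x * f x\<bar> powr p) \<partial>lebesgue) \<le> ennreal (N powr p)" for f N
  proof -
    have [measurable]: "G f N \<in> borel_measurable lebesgue" unfolding G_def by measurable
    then show "G f N \<in> borel_measurable ?M" by simp
    show "G f N x \<ge> 0" for x using N by (simp add: G_def)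
    have "(\<integral>\<^sup>+x. ennreal (G f N x powr p) \<partial>?M) = (\<integral>\<^sup>+x. ennreal (?\<sigma> x) * ennreal (G f N x powr p) \<partial>lebesgue)"
      by (rule nn_integral_density) auto
    also have "\<dots> = (\<integral>\<^sup>+x. ennreal (1 / N powr p) * ennreal (\<bar>w x * f x\<bar> powr p) \<partial>lebesgue)"
    proof (rule nn_integral_cong_AE)
      show "AE x in lebesgue. ennreal (?\<sigma> x) * ennreal (G f N x powr p)
          = ennreal (1 / N powr p) * ennreal (\<bar>w x * f x\<bar> powr p)"
        using pos
      proof eventually_elim
        case (elim x)
        have "?\<sigma> x * G f N x powr p = (w x powr (- conj_exponent p) * w x powr (conj_exponent p * p)) * \<bar>f x\<bar> powr p / N powr p"
          using elim N by (simp add: G_def powr_mult powr_divide powr_powr)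
        also have "w x powr (- conj_exponent p) * w x powr (conj_exponent p * p) = w x powr p"
          using conj_exponent(2)[OF p(1)] by (simp add: algebra_simps flip: powr_add)
        finally show ?case
          using elim by (simp add: abs_mult powr_mult flip: ennreal_mult)
      qed
    qed
    also have "\<dots> = ennreal (1 / N powr p) * (\<integral>\<^sup>+x. ennreal (\<bar>w x * f x\<bar> powr p) \<partial>lebesgue)"
      by (rule nn_integral_cmult) measurable
    also have "\<dots> \<le> ennreal (1 / N powr p) * ennreal (N powr p)"
      by (intro mult_left_mono norm) simp
    also have "\<dots> = 1" using N by (simp flip: ennreal_mult)
    finally show "(\<integral>\<^sup>+x. ennreal (G f N x powr p) \<partial>?M) \<le> 1" .
    fix P :: "int \<times> (int ^ 'n)"
    have "(\<integral>\<^sup>+x\<in>grid_cube 1 P. ennreal (G f N x) \<partial>?M)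
        = (\<integral>\<^sup>+x. ennreal (?\<sigma> x) * (ennreal (G f N x) * indicator (grid_cube 1 P) x) \<partial>lebesgue)"
      by (rule nn_integral_density) auto
    also have "\<dots> = (\<integral>\<^sup>+x. ennreal (1 / N) * (ennreal \<bar>f x\<bar> * indicator (grid_cube 1 P) x) \<partial>lebesgue)"
    proof (rule nn_integral_cong_AE)
      show "AE x in lebesgue. ennreal (?\<sigma> x) * (ennreal (G f N x) * indicator (grid_cube 1 P) x)
          = ennreal (1 / N) * (ennreal \<bar>f x\<bar> * indicator (grid_cube 1 P) x)"
        using pos
      proof eventually_elim
        case (elim x)
        then have "?\<sigma> x * G f N x = 1 / N * \<bar>f x\<bar>"
          by (simp add: G_def powr_minus field_simps)
        then show ?case
          using N by (simp add: indicator_def G_def flip: ennreal_mult)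
      qed
    qed
    also have "\<dots> = ennreal (1 / N) * (\<integral>\<^sup>+x\<in>grid_cube 1 P. ennreal \<bar>f x\<bar> \<partial>lebesgue)"
      by (rule nn_integral_cmult) measurable
    finally show "(\<integral>\<^sup>+x\<in>grid_cube 1 P. ennreal (G f N x) \<partial>?M)
       = ennreal (1 / N) * (\<integral>\<^sup>+x\<in>grid_cube 1 P. ennreal \<bar>f x\<bar> \<partial>lebesgue)" .
  qed
  show ?thesis
  proof (rule that[OF C])
    fix f N and P :: "int \<times> (int ^ 'n)"
    assume f: "f \<in> borel_measurable lebesgue" "N > 0"
        "(\<integral>\<^sup>+x. ennreal (\<bar>w x * f x\<bar> powr p) \<partial>lebesgue) \<le> ennreal (N powr p)"
    have "(\<integral>\<^sup>+x\<in>grid_cube 1 P. ennreal (G f N x) \<partial>?M) < \<infinity>"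
      by (rule nn_integral_split_bound(1)[where p = p and r = r and V = "cube_mass ?\<sigma> P"])
        (use G[OF f] p V_pos S_le S_sets in auto)
    then show "(\<integral>\<^sup>+x\<in>grid_cube 1 P. ennreal \<bar>f x\<bar> \<partial>lebesgue) < \<infinity>"
      using f(2) unfolding G(4)[OF f] by (auto simp: ennreal_mult_less_top)
  next
    fix f N assume f: "f \<in> borel_measurable lebesgue" "N > 0"
        "(\<integral>\<^sup>+x. ennreal (\<bar>w x * f x\<bar> powr p) \<partial>lebesgue) \<le> ennreal (N powr p)"
    show "(\<integral>\<^sup>+P. ennreal ((cube_mass ?\<sigma> P powr (1 / p - 1)
                * enn2real (\<integral>\<^sup>+x\<in>grid_cube 1 P. ennreal \<bar>f x\<bar> \<partial>lebesgue) / N) powr r)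
            \<partial>count_space UNIV) \<le> ennreal C"
      using emb[OF G(1-3)[OF f]] f(2) unfolding G(4)[OF f] by (simp add: enn2real_mult)
  qed
qed

section \<open>The two-weight setting and its powers of the volume\<close>

locale two_weight =
  fixes m :: nat
    and ps :: "nat \<Rightarrow> real" and p q \<alpha> :: real
    and u :: "real ^ 'n \<Rightarrow> real" and w :: "nat \<Rightarrow> real ^ 'n \<Rightarrow> real"
  assumes m: "m \<ge> 1"
    and ps: "\<And>i. i \<in> {1..m} \<Longrightarrow> 1 < ps i"
    and p_eq: "1 / p = (\<Sum>i=1..m. 1 / ps i)"
    and pq: "p < q"
    and \<alpha>: "\<alpha> < real m * real CARD('n)"
    and u [measurable]: "u \<in> borel_measurable lebesgue" and u_pos: "AE x in lebesgue. u x > 0"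
    and w [measurable (raw)]: "\<And>i. i \<in> {1..m} \<Longrightarrow> w i \<in> borel_measurable lebesgue"
    and w_pos: "\<And>i. i \<in> {1..m} \<Longrightarrow> AE x in lebesgue. w i x > 0"
    and rd: "\<And>i. i \<in> {1..m} \<Longrightarrow> reverse_doubling (\<lambda>x. w i x powr (- conj_exponent (ps i)))"
begin

abbreviation \<sigma> :: "nat \<Rightarrow> real ^ 'n \<Rightarrow> real" where
  "\<sigma> i \<equiv> \<lambda>x. w i x powr (- conj_exponent (ps i))"

text \<open>The \<open>m\<close> normalising factors of the maximal operator multiply to the volume
  to the power \<open>- \<gamma>\<close>; the same power remains in the condition once averages are
  replaced by integrals.\<close>

definition \<gamma> :: real where
  "\<gamma> = real m - \<alpha> / real CARD('n)"

lemma \<gamma>_pos: "\<gamma> > 0"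
  using \<alpha> by (simp add: \<gamma>_def field_simps)

lemma frac_maximal_term:
  assumes "Q \<in> (cubes :: (real ^ 'n) set set)"
  shows "(\<Prod>i=1..m. ennreal (1 / measure lebesgue Q powr (1 - \<alpha> / (real CARD('n) * real m))) * X i)
     = ennreal (measure lebesgue Q powr (- \<gamma>)) * (\<Prod>i=1..m. X i)"
proof -
  have "(1 / measure lebesgue Q powr (1 - \<alpha> / (real CARD('n) * real m))) ^ m
      = measure lebesgue Q powr (- ((1 - \<alpha> / (real CARD('n) * real m)) * real m))"
    using assms by (auto simp: cubes_def measure_cube powr_minus_divide power_one_over powr_powr powr_power mult.commute)
  also have "(1 - \<alpha> / (real CARD('n) * real m)) * real m = \<gamma>"
    using m by (simp add: \<gamma>_def field_simps)
  finally show ?thesis by (simp add: prod.distrib ennreal_power)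
qed

text \<open>A cube of side \<open>h\<close> containing \<open>x\<close> lies in 3P for some grid
  cube \<open>P\<close> containing \<open>x\<close>, and the side of 5P is at most
  \<open>5 * 12 * h\<close>; this is the origin of 60. The supremum of the terms is then at most the
  \<open>q\<close>-th root of the sum of their \<open>q\<close>-th powers. By \<open>fin\<close>,
  nothing is lost in \<open>enn2real\<close>.\<close>

lemma frac_maximal_le_grid_sum:
  fixes f :: "nat \<Rightarrow> real ^ 'n \<Rightarrow> real" and x :: "real ^ 'n"
  assumes q: "q > 0"
    and fin: "\<And>i P. i \<in> {1..m} \<Longrightarrow> (\<integral>\<^sup>+y\<in>grid_cube 1 P. ennreal \<bar>f i y\<bar> \<partial>lebesgue) < \<infinity>"
  shows "frac_maximal \<alpha> m f x epowr q
     \<le> (\<integral>\<^sup>+P. ennreal (((60 ^ CARD('n)) powr \<gamma> * measure lebesgue (grid_cube 2 P) powr (- \<gamma>)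
            * (\<Prod>i=1..m. enn2real (\<integral>\<^sup>+y\<in>grid_cube 1 P. ennreal \<bar>f i y\<bar> \<partial>lebesgue))) powr q)
          * indicator (grid_cube 0 P) x \<partial>count_space UNIV)"
    (is "_ \<le> (\<integral>\<^sup>+P. ennreal (?t P powr q) * _ \<partial>_)")
proof -
  let ?Z = "\<integral>\<^sup>+P. ennreal (?t P powr q) * indicator (grid_cube 0 P) x \<partial>count_space UNIV"
  have t0: "?t P \<ge> 0" for P by (auto intro!: mult_nonneg_nonneg prod_nonneg)
  have "frac_maximal \<alpha> m f x \<le> ?Z epowr (1 / q)"
    unfolding frac_maximal_def
  proof (rule SUP_least)
    fix Q assume "Q \<in> {Q \<in> cubes. x \<in> Q}"
    then obtain a h where Q: "Q = cube a h" "h > 0" "x \<in> cube a h" "Q \<in> cubes"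
      by (auto simp: cubes_def)
    obtain P where P: "x \<in> grid_cube 0 P" "cube a h \<subseteq> grid_cube 1 P" "level_side (fst P) \<le> 12 * h"
      using cube_subset_grid_cube[OF Q(2,3)] .
    have "measure lebesgue (grid_cube 2 P) = (5 * level_side (fst P)) ^ CARD('n)"
      using level_side_pos[of "fst P"] by (simp add: grid_cube_def measure_cube)
    also have "\<dots> \<le> (60 * h) ^ CARD('n)"
      using P(3) level_side_pos[of "fst P"] by (intro power_mono) auto
    also have "\<dots> = 60 ^ CARD('n) * measure lebesgue Q" using Q by (simp add: measure_cube power_mult_distrib)
    finally have le: "measure lebesgue (grid_cube 2 P) \<le> 60 ^ CARD('n) * measure lebesgue Q" .
    have pos: "measure lebesgue (grid_cube 2 P) > 0" "measure lebesgue Q > 0"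
      using level_side_pos[of "fst P"] Q by (auto simp: grid_cube_def measure_cube)
    have "(60 ^ CARD('n) * measure lebesgue Q) powr (- \<gamma>) \<le> measure lebesgue (grid_cube 2 P) powr (- \<gamma>)"
      using le pos \<gamma>_pos by (intro powr_mono2') auto
    then have "(60 ^ CARD('n)) powr \<gamma> * (60 ^ CARD('n) * measure lebesgue Q) powr (- \<gamma>)
        \<le> (60 ^ CARD('n)) powr \<gamma> * measure lebesgue (grid_cube 2 P) powr (- \<gamma>)"
      by (intro mult_left_mono) auto
    moreover have "(60 ^ CARD('n)) powr \<gamma> * (60 ^ CARD('n) * measure lebesgue Q) powr (- \<gamma>) = measure lebesgue Q powr (- \<gamma>)"
      using pos by (simp add: powr_mult powr_minus)
    ultimately have vol: "measure lebesgue Q powr (- \<gamma>)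
        \<le> (60 ^ CARD('n)) powr \<gamma> * measure lebesgue (grid_cube 2 P) powr (- \<gamma>)" by simp
    have "(\<Prod>i=1..m. ennreal (1 / measure lebesgue Q powr (1 - \<alpha> / (real CARD('n) * real m)))
                   * (\<integral>\<^sup>+y\<in>Q. ennreal \<bar>f i y\<bar> \<partial>lebesgue))
        = ennreal (measure lebesgue Q powr (- \<gamma>)) * (\<Prod>i=1..m. \<integral>\<^sup>+y\<in>Q. ennreal \<bar>f i y\<bar> \<partial>lebesgue)"
      by (rule frac_maximal_term[OF Q(4)])
    also have "\<dots> \<le> ennreal ((60 ^ CARD('n)) powr \<gamma> * measure lebesgue (grid_cube 2 P) powr (- \<gamma>))
        * (\<Prod>i=1..m. ennreal (enn2real (\<integral>\<^sup>+y\<in>grid_cube 1 P. ennreal \<bar>f i y\<bar> \<partial>lebesgue)))"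
    proof (rule mult_mono)
      show "ennreal (measure lebesgue Q powr (- \<gamma>))
          \<le> ennreal ((60 ^ CARD('n)) powr \<gamma> * measure lebesgue (grid_cube 2 P) powr (- \<gamma>))"
        using vol by (rule ennreal_leI)
      show "(\<Prod>i=1..m. \<integral>\<^sup>+y\<in>Q. ennreal \<bar>f i y\<bar> \<partial>lebesgue)
          \<le> (\<Prod>i=1..m. ennreal (enn2real (\<integral>\<^sup>+y\<in>grid_cube 1 P. ennreal \<bar>f i y\<bar> \<partial>lebesgue)))"
      proof (rule prod_mono_ennreal)
        fix i assume i: "i \<in> {1..m}"
        have "(\<integral>\<^sup>+y\<in>Q. ennreal \<bar>f i y\<bar> \<partial>lebesgue) \<le> (\<integral>\<^sup>+y\<in>grid_cube 1 P. ennreal \<bar>f i y\<bar> \<partial>lebesgue)"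
          using P(2) Q(1) by (intro nn_integral_mono) (auto simp: indicator_def)
        also have "\<dots> = ennreal (enn2real (\<integral>\<^sup>+y\<in>grid_cube 1 P. ennreal \<bar>f i y\<bar> \<partial>lebesgue))"
          using fin[OF i, of P] by simp
        finally show "(\<integral>\<^sup>+y\<in>Q. ennreal \<bar>f i y\<bar> \<partial>lebesgue)
            \<le> ennreal (enn2real (\<integral>\<^sup>+y\<in>grid_cube 1 P. ennreal \<bar>f i y\<bar> \<partial>lebesgue))" .
      qed
    qed auto
    also have "\<dots> = ennreal (?t P)"
      by (simp add: prod_ennreal ennreal_mult prod_nonneg)
    also have "\<dots> = (ennreal (?t P powr q)) epowr (1 / q)"
      using q t0[of P] by (simp add: epowr_ennreal powr_powr)
    also have "\<dots> \<le> ?Z epowr (1 / q)"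
    proof (rule epowr_mono)
      have "ennreal (?t P powr q) = (\<integral>\<^sup>+P'. ennreal (?t P powr q) * indicator {P} P' \<partial>count_space UNIV)"
        by (simp add: nn_integral_cmult)
      also have "\<dots> \<le> ?Z"
        using P(1) by (intro nn_integral_mono) (auto simp: indicator_def)
      finally show "ennreal (?t P powr q) \<le> ?Z" .
    qed (use q in simp)
    finally show "(\<Prod>i=1..m. ennreal (1 / measure lebesgue Q powr (1 - \<alpha> / (real CARD('n) * real m)))
                   * (\<integral>\<^sup>+y\<in>Q. ennreal \<bar>f i y\<bar> \<partial>lebesgue)) \<le> ?Z epowr (1 / q)" .
  qed
  then have "frac_maximal \<alpha> m f x epowr q \<le> (?Z epowr (1 / q)) epowr q"
    using q by (intro epowr_mono) auto
  then show ?thesis using q by (simp add: epowr_inverse)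
qed

lemma p_pos: "p > 0"
proof -
  have "(\<Sum>i=1..m. 1 / ps i) > 0"
  proof (rule sum_pos)
    fix i assume "i \<in> {1..m}"
    then show "1 / ps i > 0" using ps[of i] by simp
  qed (use m in auto)
  then show ?thesis unfolding p_eq[symmetric] by simp
qed

lemma sum_conj: "(\<Sum>i=1..m. 1 / conj_exponent (ps i)) = real m - 1 / p"
proof -
  have "(\<Sum>i=1..m. 1 / conj_exponent (ps i)) = (\<Sum>i=1..m. 1 - 1 / ps i)"
    by (intro sum.cong refl conj_exponent(1) ps)
  then show ?thesis by (simp add: sum_subtractf p_eq)
qed

lemma \<sigma>_weight: "i \<in> {1..m} \<Longrightarrow> weight (\<sigma> i)"
  using rd by (simp add: reverse_doubling_def)

text \<open>The averages contribute the exponents \<open>- 1 / q\<close> and, by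
  \<open>sum_conj\<close>, \<open>1 / p - real m\<close> of the volume; with the explicit exponent
  they add up to \<open>- \<gamma>\<close>.\<close>

lemma condition_term:
  fixes Q :: "(real ^ 'n) set"
  assumes "Q \<in> cubes"
  shows "ennreal (measure lebesgue Q powr (\<alpha> / real CARD('n) + 1 / q - 1 / p))
            * avg Q (\<lambda>x. u x powr q) epowr (1 / q)
            * (\<Prod>i=1..m. avg Q (\<sigma> i) epowr (1 / conj_exponent (ps i)))
     = ennreal (measure lebesgue Q powr (- \<gamma>)) * weighted_measure (\<lambda>x. u x powr q) Q epowr (1 / q)
            * (\<Prod>i=1..m. weighted_measure (\<sigma> i) Q epowr (1 / conj_exponent (ps i)))"
proof -
  define L where "L = measure lebesgue Q"
  have L: "L > 0" using assms by (auto simp: L_def cubes_def measure_cube)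
  have avg: "avg Q g epowr s = ennreal (L powr (- s)) * weighted_measure g Q epowr s" for g s
    using L by (simp add: avg_def weighted_measure_def epowr_mult epowr_ennreal powr_divide powr_minus_divide L_def)
  have "(\<Prod>i=1..m. ennreal (L powr (- (1 / conj_exponent (ps i)))))
      = ennreal (L powr (\<Sum>i=1..m. - (1 / conj_exponent (ps i))))"
    using L by (simp add: prod_ennreal powr_sum)
  also have "(\<Sum>i=1..m. - (1 / conj_exponent (ps i))) = 1 / p - real m"
    using sum_conj by (simp add: sum_negf)
  finally have pr: "(\<Prod>i=1..m. ennreal (L powr (- (1 / conj_exponent (ps i))))) = ennreal (L powr (1 / p - real m))" .
  have "ennreal (L powr (\<alpha> / real CARD('n) + 1 / q - 1 / p))
            * avg Q (\<lambda>x. u x powr q) epowr (1 / q)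
            * (\<Prod>i=1..m. avg Q (\<sigma> i) epowr (1 / conj_exponent (ps i)))
      = (ennreal (L powr (\<alpha> / real CARD('n) + 1 / q - 1 / p)) * ennreal (L powr (- (1 / q))) * ennreal (L powr (1 / p - real m)))
          * weighted_measure (\<lambda>x. u x powr q) Q epowr (1 / q)
            * (\<Prod>i=1..m. weighted_measure (\<sigma> i) Q epowr (1 / conj_exponent (ps i)))"
    unfolding avg prod.distrib pr by (simp add: mult_ac)
  also have "ennreal (L powr (\<alpha> / real CARD('n) + 1 / q - 1 / p)) * ennreal (L powr (- (1 / q))) * ennreal (L powr (1 / p - real m))
      = ennreal (L powr (- \<gamma>))"
    by (simp add: \<gamma>_def flip: ennreal_mult powr_add)
  finally show ?thesis by (simp add: L_def)
qed

section \<open>Necessity of the condition\<close>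

text \<open>Since \<open>(w i * \<sigma> i) powr ps i = \<sigma> i\<close> a.e., the test function
  \<open>\<sigma> i\<close> on \<open>Q\<close> has integral \<open>v i\<close>, and the
  \<open>ps i\<close>-th power of its weighted norm is also \<open>v i\<close>. Dividing the
  inequality by the norms leaves the powers \<open>1 - 1 / ps i\<close> of \<open>v i\<close>, which
  are those of the condition.\<close>

lemma necessity:
  assumes C: "C > 0"
    and bound: "\<And>f. (\<forall>i\<in>{1..m}. f i \<in> weighted_L (\<lambda>x. w i x powr ps i) (ps i)) \<Longrightarrow>
               Lnorm q (\<lambda>x. ennreal (u x) * frac_maximal \<alpha> m f x)
                 \<le> ennreal C * (\<Prod>i=1..m. Lnorm (ps i) (\<lambda>x. ennreal \<bar>w i x * f i x\<bar>))"
    and Q: "Q \<in> (cubes :: (real ^ 'n) set set)"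
  shows "ennreal (measure lebesgue Q powr (- \<gamma>)) * weighted_measure (\<lambda>x. u x powr q) Q epowr (1 / q)
            * (\<Prod>i=1..m. weighted_measure (\<sigma> i) Q epowr (1 / conj_exponent (ps i))) \<le> ennreal C"
proof -
  obtain a h where ah: "Q = cube a h" "h > 0" using Q by (auto simp: cubes_def)
  then have [measurable]: "Q \<in> sets lebesgue" by simp
  define v where "v i = enn2real (weighted_measure (\<sigma> i) Q)" for i
  have v: "weighted_measure (\<sigma> i) Q = ennreal (v i)" "v i > 0" if "i \<in> {1..m}" for i
  proof -
    have "weighted_measure (\<sigma> i) Q < \<infinity>" "weighted_measure (\<sigma> i) Q > 0"
      using \<sigma>_weight[OF that] ah
      by (auto intro!: weighted_measure_cube_finite weighted_measure_cube_pos simp: weight_def simp del: infinity_ennreal_def)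
    then show "weighted_measure (\<sigma> i) Q = ennreal (v i)" "v i > 0"
      by (auto simp: v_def enn2real_positive_iff)
  qed
  define f where "f i x = \<sigma> i x * indicator Q x" for i x
  have pw: "\<sigma> i x powr ps i * w i x powr ps i = \<sigma> i x" if "i \<in> {1..m}" "w i x > 0" for i x
  proof -
    have "\<sigma> i x powr ps i * w i x powr ps i = w i x powr (ps i - conj_exponent (ps i) * ps i)"
      by (simp add: powr_powr flip: powr_add)
    also have "ps i - conj_exponent (ps i) * ps i = - conj_exponent (ps i)"
      using conj_exponent(2)[OF ps[OF that(1)]] by (simp add: algebra_simps)
    finally show ?thesis .
  qed
  have int1: "(\<integral>\<^sup>+x. ennreal (\<bar>f i x\<bar> powr ps i * w i x powr ps i) \<partial>lebesgue) = ennreal (v i)"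
    and int2: "(\<integral>\<^sup>+x. ennreal \<bar>w i x * f i x\<bar> epowr ps i \<partial>lebesgue) = ennreal (v i)" if i: "i \<in> {1..m}" for i
  proof -
    have "(\<integral>\<^sup>+x. ennreal (\<bar>f i x\<bar> powr ps i * w i x powr ps i) \<partial>lebesgue) = weighted_measure (\<sigma> i) Q"
      unfolding weighted_measure_def
    proof (rule nn_integral_cong_AE)
      show "AE x in lebesgue. ennreal (\<bar>f i x\<bar> powr ps i * w i x powr ps i) = ennreal (\<sigma> i x) * indicator Q x"
        using w_pos[OF i] by eventually_elim (use pw[OF i] in \<open>auto simp: f_def indicator_def\<close>)
    qed
    then show 1: "(\<integral>\<^sup>+x. ennreal (\<bar>f i x\<bar> powr ps i * w i x powr ps i) \<partial>lebesgue) = ennreal (v i)"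
      using v[OF i] by simp
    have "(\<integral>\<^sup>+x. ennreal \<bar>w i x * f i x\<bar> epowr ps i \<partial>lebesgue)
        = (\<integral>\<^sup>+x. ennreal (\<bar>f i x\<bar> powr ps i * w i x powr ps i) \<partial>lebesgue)"
    proof (rule nn_integral_cong_AE)
      show "AE x in lebesgue. ennreal \<bar>w i x * f i x\<bar> epowr ps i = ennreal (\<bar>f i x\<bar> powr ps i * w i x powr ps i)"
        using w_pos[OF i] by eventually_elim (auto simp: epowr_ennreal abs_mult powr_mult mult.commute)
    qed
    with 1 show "(\<integral>\<^sup>+x. ennreal \<bar>w i x * f i x\<bar> epowr ps i \<partial>lebesgue) = ennreal (v i)" by simp
  qed
  have mem: "\<forall>i\<in>{1..m}. f i \<in> weighted_L (\<lambda>x. w i x powr ps i) (ps i)"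
  proof
    fix i assume i: "i \<in> {1..m}"
    note w[OF i, measurable]
    have "f i \<in> borel_measurable lebesgue" unfolding f_def by measurable
    moreover have "weighted_Lnorm (\<lambda>x. w i x powr ps i) (ps i) (f i) < \<infinity>"
      using v(2)[OF i] by (simp add: weighted_Lnorm_def int1[OF i] epowr_ennreal)
    ultimately show "f i \<in> weighted_L (\<lambda>x. w i x powr ps i) (ps i)"
      by (simp add: weighted_L_def)
  qed
  \<comment> \<open>\<open>T\<close> is the term of \<open>Q\<close> itself in the supremum, hence a
    lower bound for the maximal function on all of \<open>Q\<close>.\<close>
  define T where "T = measure lebesgue Q powr (- \<gamma>) * (\<Prod>i=1..m. v i)"
  have v0: "(\<Prod>i=1..m. v i) \<ge> 0" by (intro prod_nonneg ballI less_imp_le[OF v(2)])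
  have T0: "T \<ge> 0" unfolding T_def
    by (intro mult_nonneg_nonneg prod_nonneg ballI less_imp_le[OF v(2)]) auto
  have T_le: "ennreal T \<le> frac_maximal \<alpha> m f x" if "x \<in> Q" for x
  proof -
    have "ennreal T = ennreal (measure lebesgue Q powr (- \<gamma>)) * (\<Prod>i=1..m. ennreal (v i))"
      unfolding T_def using v0 by (subst prod_ennreal) (auto simp: ennreal_mult intro: less_imp_le[OF v(2)])
    also have "(\<Prod>i=1..m. ennreal (v i)) = (\<Prod>i=1..m. \<integral>\<^sup>+y\<in>Q. ennreal \<bar>f i y\<bar> \<partial>lebesgue)"
    proof (rule prod.cong)
      fix i assume "i \<in> {1..m}"
      then have "ennreal (v i) = weighted_measure (\<sigma> i) Q" using v by simp
      also have "\<dots> = (\<integral>\<^sup>+y\<in>Q. ennreal \<bar>f i y\<bar> \<partial>lebesgue)"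
        unfolding weighted_measure_def by (intro nn_integral_cong) (auto simp: f_def indicator_def)
      finally show "ennreal (v i) = (\<integral>\<^sup>+y\<in>Q. ennreal \<bar>f i y\<bar> \<partial>lebesgue)" .
    qed simp
    finally have "ennreal T = (\<Prod>i=1..m. ennreal (1 / measure lebesgue Q powr (1 - \<alpha> / (real CARD('n) * real m)))
                   * (\<integral>\<^sup>+y\<in>Q. ennreal \<bar>f i y\<bar> \<partial>lebesgue))"
      using frac_maximal_term[OF Q] by simp
    then show ?thesis
      unfolding frac_maximal_def using Q that by (intro SUP_upper2[of Q]) auto
  qed
  have "ennreal (T powr q) * weighted_measure (\<lambda>x. u x powr q) Q
      = (\<integral>\<^sup>+x. ennreal (T powr q) * (ennreal (u x powr q) * indicator Q x) \<partial>lebesgue)"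
    unfolding weighted_measure_def by (rule nn_integral_cmult[symmetric]) measurable
  also have "\<dots> \<le> (\<integral>\<^sup>+x. (ennreal (u x) * frac_maximal \<alpha> m f x) epowr q \<partial>lebesgue)"
  proof (rule nn_integral_mono_AE)
    show "AE x in lebesgue. ennreal (T powr q) * (ennreal (u x powr q) * indicator Q x)
        \<le> (ennreal (u x) * frac_maximal \<alpha> m f x) epowr q"
      using u_pos
    proof eventually_elim
      case (elim x)
      show ?case
      proof (cases "x \<in> Q")
        case True
        have "ennreal (T powr q) * ennreal (u x powr q) = ennreal (u x) epowr q * ennreal T epowr q"
          using elim T0 by (simp add: epowr_ennreal mult.commute)
        also have "\<dots> \<le> ennreal (u x) epowr q * frac_maximal \<alpha> m f x epowr q"
          using p_pos pq by (intro mult_left_mono epowr_mono T_le True) auto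
        finally show ?thesis using True by (simp add: epowr_mult)
      qed simp
    qed
  qed
  finally have "(ennreal (T powr q) * weighted_measure (\<lambda>x. u x powr q) Q) epowr (1 / q)
      \<le> Lnorm q (\<lambda>x. ennreal (u x) * frac_maximal \<alpha> m f x)"
    unfolding Lnorm_def using p_pos pq by (intro epowr_mono) auto
  also have "\<dots> \<le> ennreal C * (\<Prod>i=1..m. Lnorm (ps i) (\<lambda>x. ennreal \<bar>w i x * f i x\<bar>))"
    using bound[OF mem] .
  also have "(\<Prod>i=1..m. Lnorm (ps i) (\<lambda>x. ennreal \<bar>w i x * f i x\<bar>)) = (\<Prod>i=1..m. ennreal (v i powr (1 / ps i)))"
  proof (rule prod.cong)
    fix i assume i: "i \<in> {1..m}"
    show "Lnorm (ps i) (\<lambda>x. ennreal \<bar>w i x * f i x\<bar>) = ennreal (v i powr (1 / ps i))"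
      using v(2)[OF i] unfolding Lnorm_def int2[OF i] by (simp add: epowr_ennreal)
  qed simp
  also have "\<dots> = ennreal (\<Prod>i=1..m. v i powr (1 / ps i))" by (simp add: prod_ennreal)
  finally have main: "ennreal T * weighted_measure (\<lambda>x. u x powr q) Q epowr (1 / q)
      \<le> ennreal C * ennreal (\<Prod>i=1..m. v i powr (1 / ps i))"
    using T0 p_pos pq by (simp add: epowr_mult epowr_ennreal powr_powr)
  \<comment> \<open>Multiplication by \<open>?B\<close> cancels the norms on the right; this uses
    that every \<open>v i\<close> is positive and finite.\<close>
  let ?B = "\<Prod>i=1..m. v i powr (- (1 / ps i))"
  have B: "?B \<ge> 0" by (simp add: prod_nonneg)
  have "ennreal (measure lebesgue Q powr (- \<gamma>)) * weighted_measure (\<lambda>x. u x powr q) Q epowr (1 / q)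
            * (\<Prod>i=1..m. weighted_measure (\<sigma> i) Q epowr (1 / conj_exponent (ps i)))
      = ennreal (measure lebesgue Q powr (- \<gamma>)) * weighted_measure (\<lambda>x. u x powr q) Q epowr (1 / q)
            * ennreal (\<Prod>i=1..m. v i * v i powr (- (1 / ps i)))"
  proof -
    have "weighted_measure (\<sigma> i) Q epowr (1 / conj_exponent (ps i)) = ennreal (v i * v i powr (- (1 / ps i)))"
      if "i \<in> {1..m}" for i
      using v[OF that] conj_exponent(1)[OF ps[OF that]]
      by (simp add: epowr_ennreal powr_diff powr_minus_divide)
    then have "(\<Prod>i=1..m. weighted_measure (\<sigma> i) Q epowr (1 / conj_exponent (ps i)))
        = (\<Prod>i=1..m. ennreal (v i * v i powr (- (1 / ps i))))"
      by (intro prod.cong) auto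
    also have "\<dots> = ennreal (\<Prod>i=1..m. v i * v i powr (- (1 / ps i)))"
      using v(2) by (intro prod_ennreal) (simp add: less_imp_le)
    finally show ?thesis by simp
  qed
  also have "\<dots> = ennreal ?B * (ennreal T * weighted_measure (\<lambda>x. u x powr q) Q epowr (1 / q))"
    using v0 B by (simp add: T_def prod.distrib ennreal_mult mult_ac)
  also have "\<dots> \<le> ennreal ?B * (ennreal C * ennreal (\<Prod>i=1..m. v i powr (1 / ps i)))"
    by (intro mult_left_mono main) simp
  also have "\<dots> = ennreal (C * (\<Prod>i=1..m. v i powr (- (1 / ps i)) * v i powr (1 / ps i)))"
    using B C by (simp add: prod.distrib ennreal_mult prod_nonneg mult_ac)
  also have "(\<Prod>i=1..m. v i powr (- (1 / ps i)) * v i powr (1 / ps i)) = 1"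
  proof (rule prod.neutral, rule ballI)
    fix i assume "i \<in> {1..m}"
    then show "v i powr (- (1 / ps i)) * v i powr (1 / ps i) = 1"
      using v(2)[of i] by (simp flip: powr_add)
  qed
  finally show ?thesis by simp
qed

section \<open>Sufficiency of the condition\<close>

text \<open>This covers the degenerate case in which some \<open>w i * f i\<close> has norm 0 and
  cannot be normalised.\<close>

lemma frac_maximal_zero:
  fixes f :: "nat \<Rightarrow> real ^ 'n \<Rightarrow> real"
  assumes i: "i \<in> {1..m}" and f: "AE x in lebesgue. f i x = 0"
  shows "frac_maximal \<alpha> m f x = 0"
proof -
  have "(\<integral>\<^sup>+y\<in>Q. ennreal \<bar>f i y\<bar> \<partial>lebesgue) = 0" for Q
  proof -
    have "(\<integral>\<^sup>+y\<in>Q. ennreal \<bar>f i y\<bar> \<partial>lebesgue) = (\<integral>\<^sup>+y. 0 \<partial>(lebesgue :: (real ^ 'n) measure))"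
      using f by (intro nn_integral_cong_AE) (auto elim!: eventually_mono)
    then show ?thesis by simp
  qed
  then have "(\<Prod>i=1..m. ennreal (1 / measure lebesgue Q powr (1 - \<alpha> / (real CARD('n) * real m)))
                   * (\<integral>\<^sup>+y\<in>Q. ennreal \<bar>f i y\<bar> \<partial>lebesgue)) = 0" for Q
    using i by (intro prod_zero) (auto intro!: bexI[of _ i])
  then have "frac_maximal \<alpha> m f x \<le> 0"
    unfolding frac_maximal_def by (intro SUP_least) simp
  then show ?thesis by simp
qed

lemma sufficiency:
  assumes A: "A \<ge> 0" and cond: "\<And>Q. Q \<in> (cubes :: (real ^ 'n) set set) \<Longrightarrow>
      ennreal (measure lebesgue Q powr (- \<gamma>)) * weighted_measure (\<lambda>x. u x powr q) Q epowr (1 / q)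
            * (\<Prod>i=1..m. weighted_measure (\<sigma> i) Q epowr (1 / conj_exponent (ps i))) \<le> ennreal A"
  obtains C where "C > 0"
    "\<And>f. (\<forall>i\<in>{1..m}. f i \<in> weighted_L (\<lambda>x. w i x powr ps i) (ps i)) \<Longrightarrow>
               Lnorm q (\<lambda>x. ennreal (u x) * frac_maximal \<alpha> m f x)
                 \<le> ennreal C * (\<Prod>i=1..m. Lnorm (ps i) (\<lambda>x. ennreal \<bar>w i x * f i x\<bar>))"
proof -
  have q: "q > 0" using p_pos pq by simp
  \<comment> \<open>These exponents satisfy \<open>r i * \<theta> i = q\<close>, and the
    \<open>\<theta> i\<close> sum to 1, so the \<open>q\<close>-th power of a product over
    \<open>i\<close> is a weighted geometric mean of \<open>r i\<close>-th powers. The hypothesis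
    \<open>p < q\<close> gives \<open>ps i < r i\<close>, as the embedding demands.\<close>
  define r where "r i = ps i * (q / p)" for i
  define \<theta> where "\<theta> i = p / ps i" for i
  have r: "ps i < r i" if "i \<in> {1..m}" for i
    using ps[OF that] p_pos pq by (simp add: r_def field_simps)
  have \<theta>: "\<theta> i > 0" "r i * \<theta> i = q" if "i \<in> {1..m}" for i
    using ps[OF that] p_pos by (simp_all add: \<theta>_def r_def)
  have "(\<Sum>i=1..m. \<theta> i) = p * (\<Sum>i=1..m. 1 / ps i)"
    by (simp add: \<theta>_def sum_distrib_left)
  then have sum_\<theta>: "(\<Sum>i=1..m. \<theta> i) = 1"
    unfolding p_eq[symmetric] using p_pos by simp
  let ?I = "\<lambda>f P. enn2real (\<integral>\<^sup>+y\<in>grid_cube 1 P. ennreal \<bar>f y\<bar> \<partial>lebesgue)"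
  \<comment> \<open>The embedding constants are chosen before any \<open>f\<close> is fixed, so the
    final constant does not depend on \<open>f\<close>.\<close>
  have "\<exists>D. \<forall>i\<in>{1..m}. D i \<ge> 0 \<and>
      (\<forall>f N. f \<in> borel_measurable lebesgue \<and> N > 0 \<and>
        (\<integral>\<^sup>+x. ennreal (\<bar>w i x * f x\<bar> powr ps i) \<partial>lebesgue) \<le> ennreal (N powr ps i) \<longrightarrow>
        (\<forall>P. (\<integral>\<^sup>+x\<in>grid_cube 1 P. ennreal \<bar>f x\<bar> \<partial>lebesgue) < \<infinity>) \<and>
        (\<integral>\<^sup>+P. ennreal ((cube_mass (\<sigma> i) P powr (1 / ps i - 1) * ?I f P / N) powr r i)
            \<partial>count_space UNIV) \<le> ennreal (D i))"
    (is "\<exists>D. \<forall>i\<in>_. ?emb i (D i)")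
  proof (rule bchoice, rule ballI)
    fix i assume i: "i \<in> {1..m}"
    show "\<exists>D. ?emb i D"
      by (rule reverse_doubling_embedding[OF w[OF i] w_pos[OF i] ps[OF i] r[OF i] rd[OF i]]) blast
  qed
  then obtain D where D: "\<And>i. i \<in> {1..m} \<Longrightarrow> ?emb i (D i)" by blast
  define E where "E = (\<Sum>i=1..m. \<theta> i * D i)"
  have E: "E \<ge> 0" unfolding E_def
    by (intro sum_nonneg mult_nonneg_nonneg) (use \<theta> D in \<open>auto intro: less_imp_le\<close>)
  define K :: real where "K = (60 ^ CARD('n)) powr \<gamma>"
  have K: "K \<ge> 0" by (simp add: K_def)
  show ?thesis
  \<comment> \<open>The summand 1 keeps the constant positive when \<open>A\<close> or
    \<open>E\<close> is 0.\<close>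
  proof (rule that[of "K * A * E powr (1 / q) + 1"])
    show "K * A * E powr (1 / q) + 1 > 0" using K A by (simp add: add_nonneg_pos)
    fix f assume f: "\<forall>i\<in>{1..m}. f i \<in> weighted_L (\<lambda>x. w i x powr ps i) (ps i)"
    let ?N = "\<lambda>i. \<integral>\<^sup>+x. ennreal (\<bar>w i x * f i x\<bar> powr ps i) \<partial>lebesgue"
    have f_meas [measurable (raw)]: "f i \<in> borel_measurable lebesgue" if "i \<in> {1..m}" for i
      using f that by (auto simp: weighted_L_def)
    have N_fin: "?N i < \<infinity>" if i: "i \<in> {1..m}" for i
    proof -
      have "?N i = (\<integral>\<^sup>+x. ennreal (\<bar>f i x\<bar> powr ps i * w i x powr ps i) \<partial>lebesgue)"
      proof (rule nn_integral_cong_AE)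
        show "AE x in lebesgue. ennreal (\<bar>w i x * f i x\<bar> powr ps i) = ennreal (\<bar>f i x\<bar> powr ps i * w i x powr ps i)"
          using w_pos[OF i] by eventually_elim (auto simp: abs_mult powr_mult mult.commute)
      qed
      also have "\<dots> < \<infinity>"
        using f i by (auto simp: weighted_L_def weighted_Lnorm_def epowr_def split: if_splits simp: less_top)
      finally show ?thesis .
    qed
    have Lnorm_eq: "Lnorm (ps i) (\<lambda>x. ennreal \<bar>w i x * f i x\<bar>) = ?N i epowr (1 / ps i)" for i
      by (simp add: Lnorm_def epowr_ennreal)
    show "Lnorm q (\<lambda>x. ennreal (u x) * frac_maximal \<alpha> m f x)
        \<le> ennreal (K * A * E powr (1 / q) + 1) * (\<Prod>i=1..m. Lnorm (ps i) (\<lambda>x. ennreal \<bar>w i x * f i x\<bar>))"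
    proof (cases "\<exists>i\<in>{1..m}. ?N i = 0")
      case True
      then obtain i where i: "i \<in> {1..m}" "?N i = 0" by blast
      note w[OF i(1), measurable] f_meas[OF i(1), measurable]
      have "AE x in lebesgue. ennreal (\<bar>w i x * f i x\<bar> powr ps i) = 0"
        using i(2) by (subst (asm) nn_integral_0_iff_AE) auto
      with w_pos[OF i(1)] have "AE x in lebesgue. f i x = 0"
        by eventually_elim (auto simp: ennreal_eq_0_iff)
      then have "frac_maximal \<alpha> m f x = 0" for x by (rule frac_maximal_zero[OF i(1)])
      then show ?thesis by (simp add: Lnorm_def)
    next
      case False
      define N where "N i = enn2real (?N i) powr (1 / ps i)" for i
      have N: "N i > 0" "?N i = ennreal (N i powr ps i)" if i: "i \<in> {1..m}" for i
      proof -
        have "enn2real (?N i) > 0"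
          using False i N_fin[OF i] by (auto simp: enn2real_positive_iff zero_less_iff_neq_zero)
        then show "N i > 0" "?N i = ennreal (N i powr ps i)"
          using N_fin[OF i] ps[OF i] by (auto simp: N_def powr_powr)
      qed
      have emb: "(\<integral>\<^sup>+x\<in>grid_cube 1 P. ennreal \<bar>f i x\<bar> \<partial>lebesgue) < \<infinity>"
          "(\<integral>\<^sup>+P. ennreal ((cube_mass (\<sigma> i) P powr (1 / ps i - 1) * ?I (f i) P / N i) powr r i)
            \<partial>count_space UNIV) \<le> ennreal (D i)" if i: "i \<in> {1..m}" for i P
      proof -
        have *: "f i \<in> borel_measurable lebesgue \<and> N i > 0 \<and> ?N i \<le> ennreal (N i powr ps i)"
          using f_meas[OF i] N[OF i] by simp
        note ** = D[OF i, THEN conjunct2, THEN spec, THEN spec, THEN mp, OF *]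
        from **[THEN conjunct1] show "(\<integral>\<^sup>+x\<in>grid_cube 1 P. ennreal \<bar>f i x\<bar> \<partial>lebesgue) < \<infinity>" ..
        from **[THEN conjunct2] show "(\<integral>\<^sup>+P. ennreal ((cube_mass (\<sigma> i) P powr (1 / ps i - 1) * ?I (f i) P / N i) powr r i)
            \<partial>count_space UNIV) \<le> ennreal (D i)" .
      qed
      \<comment> \<open>The quantity controlled by the embedding. Up to the norm \<open>N i\<close>
        and a power of the mass of 5P, it is the integral of \<open>f i\<close> over 3P.\<close>
      define X where "X i P = cube_mass (\<sigma> i) P powr (1 / ps i - 1) * ?I (f i) P / N i" for i P
      have X0: "X i P \<ge> 0" if "i \<in> {1..m}" for i P
        using N[OF that] by (simp add: X_def)
      define B where "B = (\<Prod>i=1..m. N i)"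
      have B: "B \<ge> 0" unfolding B_def by (intro prod_nonneg ballI less_imp_le[OF N(1)]) auto
      let ?W = "\<lambda>P. weighted_measure (\<lambda>x. u x powr q) (grid_cube 2 P)"
      define t where "t P = K * measure lebesgue (grid_cube 2 P) powr (- \<gamma>) * (\<Prod>i=1..m. ?I (f i) P)" for P
      have t0: "t P \<ge> 0" for P
        using K by (auto simp: t_def intro!: mult_nonneg_nonneg prod_nonneg)
      \<comment> \<open>The condition on 5P absorbs the mass of \<open>u powr q\<close> together
        with the powers of the masses of the \<open>\<sigma> i\<close>. Only the product of the
        \<open>X i P\<close> remains, and the mean inequality separates it into sums over
        \<open>i\<close>.\<close>
      have tW: "ennreal (t P powr q) * ?W P \<le> ennreal ((K * A * B) powr q) * (\<Sum>i=1..m. ennreal (\<theta> i) * ennreal (X i P powr r i))" for P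
      proof -
        let ?V = "\<lambda>i. cube_mass (\<sigma> i) P powr (1 - 1 / ps i)"
        have V: "weighted_measure (\<sigma> i) (grid_cube 2 P) epowr (1 / conj_exponent (ps i)) = ennreal (?V i)"
            "?I (f i) P = N i * X i P * ?V i" if i: "i \<in> {1..m}" for i
        proof -
          have cm: "cube_mass (\<sigma> i) P > 0" using cube_mass(2)[OF \<sigma>_weight[OF i]] .
          then show "weighted_measure (\<sigma> i) (grid_cube 2 P) epowr (1 / conj_exponent (ps i)) = ennreal (?V i)"
            using conj_exponent(1)[OF ps[OF i]]
            by (simp add: cube_mass(1)[OF \<sigma>_weight[OF i]] epowr_ennreal)
          have "cube_mass (\<sigma> i) P powr (1 / ps i - 1) * ?V i = 1"
            using cm by (simp flip: powr_add)
          then show "?I (f i) P = N i * X i P * ?V i"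
            using N(1)[OF i] by (simp add: X_def mult_ac)
        qed
        have PV: "(\<Prod>i=1..m. weighted_measure (\<sigma> i) (grid_cube 2 P) epowr (1 / conj_exponent (ps i)))
            = ennreal (\<Prod>i=1..m. ?V i)"
          by (subst prod_ennreal[symmetric]) (auto intro!: prod.cong V)
        have PI: "(\<Prod>i=1..m. ?I (f i) P) = B * (\<Prod>i=1..m. X i P) * (\<Prod>i=1..m. ?V i)"
          unfolding B_def prod.distrib[symmetric] by (intro prod.cong refl V)
        have PX: "(\<Prod>i=1..m. X i P) \<ge> 0" by (intro prod_nonneg ballI X0)
        have PV0: "(\<Prod>i=1..m. ?V i) \<ge> 0" by (intro prod_nonneg) auto
        have "ennreal (t P) * ?W P epowr (1 / q)
            = ennreal (K * B * (\<Prod>i=1..m. X i P)) * (ennreal (measure lebesgue (grid_cube 2 P) powr (- \<gamma>))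
               * ?W P epowr (1 / q) * ennreal (\<Prod>i=1..m. ?V i))"
          unfolding t_def PI using K B PX PV0 by (simp add: ennreal_mult mult_ac)
        also have "\<dots> \<le> ennreal (K * B * (\<Prod>i=1..m. X i P)) * ennreal A"
          using cond[OF grid_cube_cube, of P] unfolding PV by (intro mult_left_mono) auto
        also have "\<dots> = ennreal (K * A * B * (\<Prod>i=1..m. X i P))"
          using K A B PX by (simp add: mult_ac flip: ennreal_mult)
        finally have "(ennreal (t P) * ?W P epowr (1 / q)) epowr q \<le> ennreal (K * A * B * (\<Prod>i=1..m. X i P)) epowr q"
          using q by (intro epowr_mono) auto
        then have "ennreal (t P powr q) * ?W P \<le> ennreal ((K * A * B * (\<Prod>i=1..m. X i P)) powr q)"
          using q t0[of P] K A B PX by (simp add: epowr_mult epowr_inverse epowr_ennreal)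
        also have "(K * A * B * (\<Prod>i=1..m. X i P)) powr q = (K * A * B) powr q * (\<Prod>i=1..m. X i P) powr q"
          using K A B PX by (simp add: powr_mult)
        also have "(\<Prod>i=1..m. X i P) powr q = (\<Prod>i=1..m. (X i P powr r i) powr \<theta> i)"
          using X0 \<theta>(2) by (simp add: powr_powr prod_powr_distrib)
        also have "ennreal ((K * A * B) powr q * (\<Prod>i=1..m. (X i P powr r i) powr \<theta> i))
            \<le> ennreal ((K * A * B) powr q * (\<Sum>i=1..m. \<theta> i * X i P powr r i))"
          by (intro ennreal_leI mult_left_mono weighted_arith_geom_mean) (use m \<theta> sum_\<theta> in auto)
        also have "\<dots> = ennreal ((K * A * B) powr q) * ennreal (\<Sum>i=1..m. \<theta> i * X i P powr r i)"
          by (intro ennreal_mult sum_nonneg mult_nonneg_nonneg less_imp_le[OF \<theta>(1)]) auto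
        also have "ennreal (\<Sum>i=1..m. \<theta> i * X i P powr r i) = (\<Sum>i=1..m. ennreal (\<theta> i * X i P powr r i))"
          by (intro sum_ennreal[symmetric] mult_nonneg_nonneg less_imp_le[OF \<theta>(1)]) auto
        also have "\<dots> = (\<Sum>i=1..m. ennreal (\<theta> i) * ennreal (X i P powr r i))"
          by (intro sum.cong refl ennreal_mult less_imp_le[OF \<theta>(1)]) auto
        finally show ?thesis .
      qed
      have "(\<integral>\<^sup>+x. (ennreal (u x) * frac_maximal \<alpha> m f x) epowr q \<partial>lebesgue)
          \<le> (\<integral>\<^sup>+x. (\<integral>\<^sup>+P. ennreal (u x powr q) * (ennreal (t P powr q) * indicator (grid_cube 0 P) x) \<partial>count_space UNIV) \<partial>lebesgue)"
      proof (rule nn_integral_mono)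
        fix x :: "real ^ 'n"
        \<comment> \<open>An inequality suffices: where \<open>u x\<close> is negative the left side
          is 0.\<close>
        have "ennreal (u x) epowr q \<le> ennreal (u x powr q)"
          by (cases "u x \<ge> 0") (auto simp: epowr_ennreal ennreal_neg)
        moreover have "frac_maximal \<alpha> m f x epowr q
            \<le> (\<integral>\<^sup>+P. ennreal (t P powr q) * indicator (grid_cube 0 P) x \<partial>count_space UNIV)"
          unfolding t_def K_def by (rule frac_maximal_le_grid_sum[OF q emb(1)])
        ultimately have "(ennreal (u x) * frac_maximal \<alpha> m f x) epowr q
            \<le> ennreal (u x powr q) * (\<integral>\<^sup>+P. ennreal (t P powr q) * indicator (grid_cube 0 P) x \<partial>count_space UNIV)"
          unfolding epowr_mult by (rule mult_mono) auto
        also have "\<dots> = (\<integral>\<^sup>+P. ennreal (u x powr q) * (ennreal (t P powr q) * indicator (grid_cube 0 P) x) \<partial>count_space UNIV)"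
          by (simp add: nn_integral_cmult)
        finally show "(ennreal (u x) * frac_maximal \<alpha> m f x) epowr q
            \<le> (\<integral>\<^sup>+P. ennreal (u x powr q) * (ennreal (t P powr q) * indicator (grid_cube 0 P) x) \<partial>count_space UNIV)" .
      qed
      also have "\<dots> = (\<integral>\<^sup>+P. (\<integral>\<^sup>+x. ennreal (u x powr q) * (ennreal (t P powr q) * indicator (grid_cube 0 P) x) \<partial>lebesgue) \<partial>count_space UNIV)"
        by (rule nn_integral_count_space_nn_integral) auto
      \<comment> \<open>The cube \<open>P\<close> is enlarged to 5P, the cube to which
        \<open>tW\<close> refers.\<close>
      also have "\<dots> \<le> (\<integral>\<^sup>+P. ennreal (t P powr q) * ?W P \<partial>count_space UNIV)"
      proof (rule nn_integral_mono)
        fix P :: "int \<times> (int ^ 'n)"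
        have "(\<integral>\<^sup>+x. ennreal (u x powr q) * (ennreal (t P powr q) * indicator (grid_cube 0 P) x) \<partial>lebesgue)
            = (\<integral>\<^sup>+x. ennreal (t P powr q) * (ennreal (u x powr q) * indicator (grid_cube 0 P) x) \<partial>lebesgue)"
          by (simp add: mult_ac)
        also have "\<dots> = ennreal (t P powr q) * weighted_measure (\<lambda>x. u x powr q) (grid_cube 0 P)"
          unfolding weighted_measure_def by (rule nn_integral_cmult) measurable
        also have "\<dots> \<le> ennreal (t P powr q) * ?W P"
          by (intro mult_left_mono weighted_measure_mono grid_cube_mono) auto
        finally show "(\<integral>\<^sup>+x. ennreal (u x powr q) * (ennreal (t P powr q) * indicator (grid_cube 0 P) x) \<partial>lebesgue)
            \<le> ennreal (t P powr q) * ?W P" .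
      qed
      also have "\<dots> \<le> (\<integral>\<^sup>+P. ennreal ((K * A * B) powr q) * (\<Sum>i=1..m. ennreal (\<theta> i) * ennreal (X i P powr r i)) \<partial>count_space UNIV)"
        by (intro nn_integral_mono tW)
      also have "\<dots> = ennreal ((K * A * B) powr q) * (\<Sum>i=1..m. ennreal (\<theta> i) * (\<integral>\<^sup>+P. ennreal (X i P powr r i) \<partial>count_space UNIV))"
        by (simp add: nn_integral_cmult nn_integral_sum)
      also have "\<dots> \<le> ennreal ((K * A * B) powr q) * (\<Sum>i=1..m. ennreal (\<theta> i) * ennreal (D i))"
        unfolding X_def by (intro mult_left_mono sum_mono emb(2)) auto
      also have "(\<Sum>i=1..m. ennreal (\<theta> i) * ennreal (D i)) = (\<Sum>i=1..m. ennreal (\<theta> i * D i))"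
        using D by (intro sum.cong refl ennreal_mult[symmetric] less_imp_le[OF \<theta>(1)]) auto
      also have "\<dots> = ennreal E"
        unfolding E_def using D by (intro sum_ennreal mult_nonneg_nonneg less_imp_le[OF \<theta>(1)]) auto
      finally have "Lnorm q (\<lambda>x. ennreal (u x) * frac_maximal \<alpha> m f x)
          \<le> (ennreal ((K * A * B) powr q) * ennreal E) epowr (1 / q)"
        unfolding Lnorm_def using q by (intro epowr_mono) auto
      also have "\<dots> = ennreal (K * A * B * E powr (1 / q))"
        using q K A B E by (simp add: epowr_mult epowr_ennreal powr_powr ennreal_mult)
      also have "\<dots> \<le> ennreal ((K * A * E powr (1 / q) + 1) * B)"
        using B by (intro ennreal_leI) (simp add: algebra_simps)
      also have "\<dots> = ennreal (K * A * E powr (1 / q) + 1) * ennreal B"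
        using K A B by (intro ennreal_mult) auto
      also have "ennreal B = (\<Prod>i=1..m. ennreal (N i))"
        unfolding B_def by (intro prod_ennreal[symmetric] less_imp_le[OF N(1)])
      also have "\<dots> = (\<Prod>i=1..m. Lnorm (ps i) (\<lambda>x. ennreal \<bar>w i x * f i x\<bar>))"
      proof (rule prod.cong)
        fix i assume i: "i \<in> {1..m}"
        show "ennreal (N i) = Lnorm (ps i) (\<lambda>x. ennreal \<bar>w i x * f i x\<bar>)"
          using N[OF i] ps[OF i] unfolding Lnorm_eq by (simp add: epowr_ennreal powr_powr)
      qed simp
      finally show ?thesis .
    qed
  qed
qed

lemma characterization:
  "(\<exists>C::real. C > 0 \<and>
            (\<forall>f. (\<forall>i\<in>{1..m}. f i \<in> weighted_L (\<lambda>x. w i x powr ps i) (ps i)) \<longrightarrow>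
               Lnorm q (\<lambda>x. ennreal (u x) * frac_maximal \<alpha> m f x)
                 \<le> ennreal C * (\<Prod>i=1..m. Lnorm (ps i) (\<lambda>x. ennreal \<bar>w i x * f i x\<bar>))))
     \<longleftrightarrow>
         (SUP Q \<in> (cubes :: (real ^ 'n) set set).
            ennreal (measure lebesgue Q powr (\<alpha> / real CARD('n) + 1 / q - 1 / p))
            * avg Q (\<lambda>x. u x powr q) epowr (1 / q)
            * (\<Prod>i=1..m. avg Q (\<lambda>y. w i y powr (- conj_exponent (ps i)))
                           epowr (1 / conj_exponent (ps i)))) < \<infinity>"
    (is "?L \<longleftrightarrow> (SUP Q \<in> cubes. ?T Q) < \<infinity>")
proof
  assume ?L
  then obtain C where "C > 0" "\<And>f. (\<forall>i\<in>{1..m}. f i \<in> weighted_L (\<lambda>x. w i x powr ps i) (ps i)) \<Longrightarrow>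
               Lnorm q (\<lambda>x. ennreal (u x) * frac_maximal \<alpha> m f x)
                 \<le> ennreal C * (\<Prod>i=1..m. Lnorm (ps i) (\<lambda>x. ennreal \<bar>w i x * f i x\<bar>))"
    by blast
  from necessity[OF this] have "(SUP Q \<in> cubes. ?T Q) \<le> ennreal C"
    by (intro SUP_least) (simp only: condition_term)
  then show "(SUP Q \<in> cubes. ?T Q) < \<infinity>" by (simp add: le_less_trans)
next
  assume "(SUP Q \<in> cubes. ?T Q) < \<infinity>"
  then obtain A where A: "A \<ge> 0" "(SUP Q \<in> cubes. ?T Q) = ennreal A"
    unfolding infinity_ennreal_def less_top_ennreal by blast
  have cond: "ennreal (measure lebesgue Q powr (- \<gamma>)) * weighted_measure (\<lambda>x. u x powr q) Q epowr (1 / q)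
            * (\<Prod>i=1..m. weighted_measure (\<sigma> i) Q epowr (1 / conj_exponent (ps i))) \<le> ennreal A"
    if "Q \<in> cubes" for Q
    unfolding condition_term[OF that, symmetric] A(2)[symmetric] using that by (rule SUP_upper)
  show ?L
    by (rule sufficiency[OF A(1) cond]) blast+
qed

end

theorem theorem3p1:
  fixes m :: nat
    and ps :: "nat \<Rightarrow> real" and p q \<alpha> :: real
    and u :: "real ^ 'n \<Rightarrow> real" and w :: "nat \<Rightarrow> real ^ 'n \<Rightarrow> real"
  assumes "m \<ge> 1"
    and "\<And>i. i \<in> {1..m} \<Longrightarrow> 1 < ps i"
    and "1 / p = (\<Sum>i=1..m. 1 / ps i)"
    and "p < q"
    and "0 < \<alpha>" and "\<alpha> < real m * real CARD('n)"
    and "u \<in> borel_measurable lebesgue" and "AE x in lebesgue. u x > 0"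
    and "\<And>i. i \<in> {1..m} \<Longrightarrow> w i \<in> borel_measurable lebesgue"
    and "\<And>i. i \<in> {1..m} \<Longrightarrow> AE x in lebesgue. w i x > 0"
    and "\<And>i. i \<in> {1..m} \<Longrightarrow> reverse_doubling (\<lambda>x. w i x powr (- conj_exponent (ps i)))"
  shows "(\<exists>C::real. C > 0 \<and>
            (\<forall>f. (\<forall>i\<in>{1..m}. f i \<in> weighted_L (\<lambda>x. w i x powr ps i) (ps i)) \<longrightarrow>
               Lnorm q (\<lambda>x. ennreal (u x) * frac_maximal \<alpha> m f x)
                 \<le> ennreal C * (\<Prod>i=1..m. Lnorm (ps i) (\<lambda>x. ennreal \<bar>w i x * f i x\<bar>))))
     \<longleftrightarrow>
         (SUP Q \<in> (cubes :: (real ^ 'n) set set).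
            ennreal (measure lebesgue Q powr (\<alpha> / real CARD('n) + 1 / q - 1 / p))
            * avg Q (\<lambda>x. u x powr q) epowr (1 / q)
            * (\<Prod>i=1..m. avg Q (\<lambda>y. w i y powr (- conj_exponent (ps i)))
                           epowr (1 / conj_exponent (ps i)))) < \<infinity>"
proof -
  interpret two_weight m ps p q \<alpha> u w
    by unfold_locales (use assms in auto)
  show ?thesis by (rule characterization)
qed

end
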